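(* Let $(\mathrm{k},\mathrm{d},\Pi)$ be a triplet with $\mathrm{k},\mathrm{d}\geq 0$ and $\Pi$ a measure on $\mathbb{R}_+$ with $\int_{\mathbb{R}_+}(1\wedge x)\,\Pi(dx)<\infty$, satisfying in addition $\int_{\mathbb{R}_+} e^{\alpha u}u\,\Pi(du)<\infty$ for all $\alpha\geq 0$. For $\gamma>0$ let $X_\gamma$ be a positive random variable with $$\mathbb{E}(e^{-\theta X_\gamma}) = \exp(-\gamma\Lambda_X(\theta)),\qquad \Lambda_X(\theta) = \mathrm{k}+\mathrm{d}\,\theta+\int_0^{+\infty}(1-e^{-\theta u})\,\Pi(du).$$ Let $\Phi:\mathbb{R}_+\to\mathbb{R}_+$ be a continuous positive integrable function such that $\Phi(\Lambda_X'(0))=1$. Define the distribution of a random variable $\mathcal{X}_\gamma(\Phi)$ by $$\mathbb{E}\big(f(\mathcal{X}_\gamma(\Phi))\big) = \frac{\mathbb{E}\big(f(X_\gamma)\,\Phi(X_\gamma/\gamma)\big)}{\mathbb{E}\big(\Phi(X_\gamma/\gamma)\big)}$$ for all bounded measurable $f$. Let $\Upsilon(x) := \inf\{y\in\mathbb{R} : \Lambda_X'(y)\leq x\}$, with the convention $\inf\emptyset := \infty$. Then, locally uniformly in $x\in\mathbb{R}_+$, $$\frac{\mathbb{E}\big(e^{-\Upsilon(x)\mathcal{X}_\gamma(\Phi)}\big)}{\mathbb{E}\big(e^{-\Upsilon(x)X_\gamma}\big)}\longrightarrow \Phi(x)\qquad\text{as }\gamma\to+\infty.$$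
   Context: The derivative of $\Lambda_X$ is $\Lambda_X'(y) = \mathrm{d}+\int_0^{+\infty}u\,e^{-uy}\,\Pi(du)$, $y\in\mathbb{R}$, which is a decreasing function of $y\in\mathbb{R}$; $\Upsilon$ is its inverse bijection. The law of $X_\gamma$ is that of the value at time $\gamma$ of a subordinator with characteristic triplet $(\mathrm{k},\mathrm{d},\Pi)$.
   Formalization: Φ is also assumed to satisfy Φ(x) ≤ C e^{cx} for some C, c (otherwise E Φ(X_γ/γ) may be infinite or diverge); X_γ is finite, which forces k = 0; and the convergence is stated only at those x ≥ 0 where the quotient is meaningful (not 0/0, and Υ(x) not −∞). *)

theory Defs
  imports "HOL-Probability.Probability"
begin

text \<open>A measure on $[0,\infty)$ is rendered as a Borel measure on the real line that does not
  charge the negative half-line.\<close>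

definition subordinator_triplet :: "real \<Rightarrow> real \<Rightarrow> real measure \<Rightarrow> bool" where
  "subordinator_triplet k d \<nu> \<longleftrightarrow>
     0 \<le> k \<and> 0 \<le> d \<and> sets \<nu> = sets borel \<and> emeasure \<nu> {..<0} = 0 \<and>
     integrable \<nu> (\<lambda>x. min 1 x)"

definition laplace_exponent :: "real \<Rightarrow> real \<Rightarrow> real measure \<Rightarrow> real \<Rightarrow> real" where
  "laplace_exponent k d \<nu> \<theta> = k + d * \<theta> + (\<integral>u. (1 - exp (- \<theta> * u)) \<partial>\<nu>)"

text \<open>The infimum is taken in the extended reals, so that it is \<open>\<infinity>\<close> for the empty set.\<close>

definition Upsilon :: "real \<Rightarrow> real \<Rightarrow> real measure \<Rightarrow> real \<Rightarrow> ereal" where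
  "Upsilon k d \<nu> x = (INF y\<in>{y. deriv (laplace_exponent k d \<nu>) y \<le> x}. ereal y)"

text \<open>$e^{-yu}$ for $y \in (-\infty,\infty]$ and $u \ge 0$, with $\infty \cdot 0 = 0$ and
  $e^{-\infty} = 0$. The value at \<open>y = -\<infinity>\<close> has no meaning.\<close>

definition exp_neg :: "ereal \<Rightarrow> real \<Rightarrow> real" where
  "exp_neg y u = (if y = \<infinity> then (if u = 0 then 1 else 0) else exp (- real_of_ereal y * u))"

text \<open>The points $x \ge 0$ at which a quotient with denominator $E(e^{-\Upsilon(x) X_\gamma})$ is
  meaningful: those with finite $\Upsilon(x)$, and those with $\Upsilon(x) = \infty$ for which
  the denominator, in this case $P(X_\gamma = 0)$, does not vanish. If \<open>\<nu>\<close> charges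
  $(0,\infty)$, then $\Upsilon(x)$ is finite exactly for $x > d$, the range of the derivative of
  the Laplace exponent being $(d,\infty)$. For $0 \le x < d$ the quotient is always $0/0$.\<close>

definition ratio_domain ::
  "real \<Rightarrow> real \<Rightarrow> real measure \<Rightarrow> (real \<Rightarrow> 'a measure) \<Rightarrow> (real \<Rightarrow> 'a \<Rightarrow> real) \<Rightarrow> real set" where
  "ratio_domain k d \<nu> M X =
     {x. 0 \<le> x \<and> Upsilon k d \<nu> x \<noteq> -\<infinity> \<and>
         (Upsilon k d \<nu> x = \<infinity> \<longrightarrow>
            (\<forall>\<gamma>>0. (\<integral>\<omega>. exp_neg (Upsilon k d \<nu> x) (X \<gamma> \<omega>) \<partial>M \<gamma>) \<noteq> 0))}"

end

theory Submission
  imports Defs "HOL-Complex_Analysis.Complex_Analysis"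
begin

text \<open>Under the law of \<open>X\<^sub>\<gamma>\<close> tilted by \<open>exp (- y X\<^sub>\<gamma>)\<close>, with \<open>y\<close> the value of \<open>\<Upsilon>\<close> at \<open>x\<close>, the variable
  \<open>X\<^sub>\<gamma> / \<gamma>\<close> has mean \<open>x\<close> and concentrates there as \<open>\<gamma>\<close> grows, so the tilted expectation of
  \<open>\<Phi> (X\<^sub>\<gamma> / \<gamma>)\<close> tends to \<open>\<Phi> x\<close>; the case \<open>y = 0\<close> gives the normalising constant. The
  concentration is uniform because the second-order Taylor remainder of the Laplace exponent is
  uniform on half-lines \<open>[y\<^sub>0, \<infinity>)\<close>, and it is exponential in \<open>X\<^sub>\<gamma> / \<gamma>\<close>, so that \<open>\<Phi>\<close> may grow
  exponentially. Negative \<open>y\<close> requires the Laplace transform on the whole line, obtained by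
  analytic continuation. If \<open>\<Upsilon>\<close> is infinite at \<open>x\<close> and \<open>X\<^sub>\<gamma>\<close> has an atom at 0, then \<open>x = 0\<close>
  and the ratio is \<open>\<Phi> 0\<close> divided by the normalising constant.\<close>

section \<open>Power series and parameter integrals\<close>

lemma exp_taylor2_nonneg: "0 \<le> exp t - 1 - (t::real)"
  using exp_ge_add_one_self[of t] by linarith

text \<open>Multiplying 1 - t \<le> exp (- t) by exp t gives exp t - 1 \<le> t * exp t, which
  replaces the remainder by t * (exp t - 1); each factor is then bounded in absolute value. No sign
  of \<open>t\<close> is assumed, so increments in both directions are covered.\<close>

lemma exp_taylor2_le: "exp t - 1 - t \<le> t\<^sup>2 * exp \<bar>t\<bar>" for t :: real
proof -
  have "exp t - 1 - t \<le> t * (exp t - 1)"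
  proof -
    have "(1 - t) * exp t \<le> exp (- t) * exp t"
      using exp_ge_add_one_self[of "- t"] by (intro mult_right_mono) auto
    then show ?thesis by (simp add: exp_minus algebra_simps)
  qed
  also have "\<dots> \<le> \<bar>t\<bar> * (\<bar>t\<bar> * exp \<bar>t\<bar>)"
  proof (cases "0 \<le> t")
    case True
    have "(1 - t) * exp t \<le> exp (- t) * exp t"
      using exp_ge_add_one_self[of "- t"] by (intro mult_right_mono) auto
    then have "exp t - 1 \<le> t * exp t" by (simp add: exp_minus algebra_simps)
    with True show ?thesis by (simp add: mult_left_mono)
  next
    case False
    have "(- t) * (1 - exp t) \<le> (- t) * (- t)"
      using False exp_ge_add_one_self[of t] by (intro mult_left_mono) linarith+
    also have "\<dots> \<le> (- t) * ((- t) * exp (- t))"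
      using False by (intro mult_left_mono) (simp_all add: mult_le_cancel_left1)
    finally show ?thesis using False by (simp add: algebra_simps)
  qed
  finally show ?thesis by (simp add: power2_eq_square mult.assoc)
qed

lemma exp_diff_one_le: "\<bar>exp t - 1\<bar> \<le> \<bar>t\<bar> * exp \<bar>t\<bar>" for t :: real
proof -
  have "(1 - \<bar>t\<bar>) * exp \<bar>t\<bar> \<le> exp (- \<bar>t\<bar>) * exp \<bar>t\<bar>"
    using exp_ge_add_one_self[of "- \<bar>t\<bar>"] by (intro mult_right_mono) auto
  then have *: "exp \<bar>t\<bar> - 1 \<le> \<bar>t\<bar> * exp \<bar>t\<bar>" by (simp add: exp_minus algebra_simps)
  have "\<bar>exp t - 1\<bar> \<le> exp \<bar>t\<bar> - 1"
  proof (cases "0 \<le> t")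
    case False
    then have "exp t \<le> 1" by simp
    \<comment> \<open>For negative \<open>t\<close> this gives 1 - exp t \<le> exp (- t) - 1, which
      is the claim.\<close>
    moreover have "2 \<le> exp t + exp (- t)"
      using exp_ge_add_one_self[of t] exp_ge_add_one_self[of "-t"] by linarith
    ultimately show ?thesis using False by simp
  qed auto
  with * show ?thesis by linarith
qed

text \<open>Since the coefficients are non-negative, the absolute n-th term has integral
  (\<integral> \<open>f n\<close>) * |s|^n. Summability of these numbers gives absolute convergence
  almost everywhere and allows termwise integration, so integrability of \<open>G\<close> is a
  conclusion rather than a hypothesis.\<close>

lemma sums_power_series_integral_converse:
  fixes f :: "nat \<Rightarrow> 'a \<Rightarrow> real"
  assumes int: "\<And>n. integrable M (f n)"
    and nonneg: "AE x in M. \<forall>n. 0 \<le> f n x"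
    and sums: "AE x in M. (\<lambda>n. f n x * s ^ n) sums G x"
    and meas: "G \<in> borel_measurable M"
    and summ: "summable (\<lambda>n. (\<integral>x. f n x \<partial>M) * \<bar>s\<bar> ^ n)"
  shows "integrable M G" "(\<lambda>n. (\<integral>x. f n x \<partial>M) * s ^ n) sums (\<integral>x. G x \<partial>M)"
proof -
  let ?g = "\<lambda>n x. f n x * s ^ n"
  have norm_eq: "(\<integral>x. norm (?g n x) \<partial>M) = (\<integral>x. f n x \<partial>M) * \<bar>s\<bar> ^ n" for n
  proof -
    have "(\<integral>x. norm (?g n x) \<partial>M) = (\<integral>x. f n x * \<bar>s\<bar> ^ n \<partial>M)"
    proof (rule integral_cong_AE)
      show "AE x in M. norm (f n x * s ^ n) = f n x * \<bar>s\<bar> ^ n"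
        using nonneg by eventually_elim (simp add: abs_mult power_abs)
    qed (use int[THEN borel_measurable_integrable] in measurable)
    then show ?thesis by simp
  qed
  have i: "integrable M (?g n)" for n using int by simp
  have nn: "(\<Sum>n. ennreal (\<integral>x. norm (?g n x) \<partial>M)) \<noteq> \<top>"
    unfolding norm_eq using summ nonneg
    by (intro ennreal_suminf_neq_top) (auto intro!: mult_nonneg_nonneg integral_nonneg_AE)
  have s1: "AE x in M. summable (\<lambda>n. norm (?g n x))"
  proof -
    have "(\<integral>\<^sup>+x. (\<Sum>n. ennreal (norm (?g n x))) \<partial>M) = (\<Sum>n. \<integral>\<^sup>+x. ennreal (norm (?g n x)) \<partial>M)"
      using int by (intro nn_integral_suminf) (auto intro!: measurable_compose[OF borel_measurable_norm]
          dest: borel_measurable_integrable)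
    also have "\<dots> = (\<Sum>n. ennreal (\<integral>x. norm (?g n x) \<partial>M))"
      using i by (intro arg_cong[where f=suminf] ext nn_integral_eq_integral integrable_norm) auto
    finally have "(\<integral>\<^sup>+x. (\<Sum>n. ennreal (norm (?g n x))) \<partial>M) \<noteq> \<infinity>" using nn by simp
    then have "AE x in M. (\<Sum>n. ennreal (norm (?g n x))) \<noteq> \<infinity>"
      using int by (intro nn_integral_PInf_AE) (auto dest: borel_measurable_integrable)
    then show ?thesis
      by eventually_elim (auto intro!: summable_suminf_not_top)
  qed
  have s2: "summable (\<lambda>n. \<integral>x. norm (?g n x) \<partial>M)" unfolding norm_eq by (rule summ)
  have eq: "AE x in M. G x = (\<Sum>n. ?g n x)"
    using sums by eventually_elim (simp add: sums_iff)
  have int_s: "integrable M (\<lambda>x. \<Sum>n. ?g n x)" by (rule integrable_suminf[OF i s1 s2])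
  have eq2: "(\<integral>x. G x \<partial>M) = (\<integral>x. (\<Sum>n. ?g n x) \<partial>M)"
    using eq meas int_s by (intro integral_cong_AE) auto
  show "integrable M G"
    using integrable_cong_AE[OF meas borel_measurable_integrable[OF int_s] eq] int_s by simp
  have "(\<lambda>n. \<integral>x. ?g n x \<partial>M) sums (\<integral>x. (\<Sum>n. ?g n x) \<partial>M)"
    by (rule sums_integral[OF i s1 s2])
  then show "(\<lambda>n. (\<integral>x. f n x \<partial>M) * s ^ n) sums (\<integral>x. G x \<partial>M)"
    unfolding eq2 by simp
qed

text \<open>At the positive point \<open>r\<close> every partial sum lies below the integrable
  \<open>F\<close>. Hence each coefficient is integrable and the integrated series converges at
  \<open>r\<close>, therefore absolutely at every \<open>s\<close> with |s| \<le> r.\<close>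

lemma sums_power_series_integral:
  fixes f :: "nat \<Rightarrow> 'a \<Rightarrow> real"
  assumes meas: "\<And>n. f n \<in> borel_measurable M"
    and nonneg: "AE x in M. \<forall>n. 0 \<le> f n x"
    and sumsF: "AE x in M. (\<lambda>n. f n x * r ^ n) sums F x"
    and F: "integrable M F" and r: "0 < r" "\<bar>s\<bar> \<le> r"
    and sumsG: "AE x in M. (\<lambda>n. f n x * s ^ n) sums G x"
    and measG: "G \<in> borel_measurable M"
  shows "integrable M (f n)" "(\<lambda>n. (\<integral>x. f n x \<partial>M) * s ^ n) sums (\<integral>x. G x \<partial>M)"
proof -
  have le: "AE x in M. (\<Sum>n\<in>A. f n x * r ^ n) \<le> F x" if "finite A" for A
    using nonneg sumsF
  proof eventually_elim
    case (elim x)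
    then have "(\<Sum>n\<in>A. f n x * r ^ n) \<le> (\<Sum>n. f n x * r ^ n)"
      using that r by (intro sum_le_suminf) (auto simp: sums_iff)
    with elim show ?case by (simp add: sums_iff)
  qed
  have int: "integrable M (f n)" for n
  proof -
    have "AE x in M. norm (f n x * r ^ n) \<le> norm (F x)"
      using le[of "{n}", OF finite.intros(2)[OF finite.emptyI]] nonneg by eventually_elim (use r in auto)
    then have "integrable M (\<lambda>x. f n x * r ^ n)"
      by (intro Bochner_Integration.integrable_bound[OF F]) (use meas in measurable)
    then show ?thesis using r by simp
  qed
  then show "integrable M (f n)" .
  have "summable (\<lambda>n. (\<integral>x. f n x \<partial>M) * r ^ n)"
  proof (rule summableI_nonneg_bounded)
    show "0 \<le> (\<integral>x. f n x \<partial>M) * r ^ n" for n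
      using nonneg r by (auto intro!: mult_nonneg_nonneg integral_nonneg_AE)
    show "(\<Sum>n<N. (\<integral>x. f n x \<partial>M) * r ^ n) \<le> (\<integral>x. F x \<partial>M)" for N
    proof -
      have "(\<Sum>n<N. (\<integral>x. f n x \<partial>M) * r ^ n) = (\<integral>x. (\<Sum>n<N. f n x * r ^ n) \<partial>M)"
        using int by (subst Bochner_Integration.integral_sum) auto
      also have "\<dots> \<le> (\<integral>x. F x \<partial>M)"
        using le[of "{..<N}"] F int by (intro integral_mono_AE) auto
      finally show ?thesis .
    qed
  qed
  then have "summable (\<lambda>n. (\<integral>x. f n x \<partial>M) * \<bar>s\<bar> ^ n)"
  proof (rule summable_comparison_test'[where N = 0])
    fix n
    have "0 \<le> (\<integral>x. f n x \<partial>M)" using nonneg by (auto intro!: integral_nonneg_AE)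
    then show "norm ((\<integral>x. f n x \<partial>M) * \<bar>s\<bar> ^ n) \<le> (\<integral>x. f n x \<partial>M) * r ^ n"
      using r by (auto simp: abs_mult intro!: mult_left_mono power_mono)
  qed
  from sums_power_series_integral_converse(2)[OF int nonneg sumsG measG this]
  show "(\<lambda>n. (\<integral>x. f n x \<partial>M) * s ^ n) sums (\<integral>x. G x \<partial>M)" .
qed

text \<open>Once the coefficients below \<open>n\<close> vanish, the series can be divided by s^n;
  letting \<open>s\<close> tend to 0 then isolates the coefficient \<open>c n\<close>.\<close>

lemma powser_zero_imp_coeffs_zero:
  fixes c :: "nat \<Rightarrow> real"
  assumes r: "0 < r" and sums: "\<And>s. \<bar>s\<bar> < r \<Longrightarrow> (\<lambda>n. c n * s ^ n) sums 0"
  shows "c n = 0"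
proof (induction n rule: less_induct)
  case (less n)
  have "(\<lambda>k. c (k + n) * s ^ k) sums 0" if s: "s \<noteq> 0" "norm s < r" for s
  proof -
    have "(\<lambda>k. c (k + n) * s ^ (k + n)) sums (0 - (\<Sum>k<n. c k * s ^ k))"
      using sums[of s] s by (intro sums_split_initial_segment) auto
    then have "(\<lambda>k. s ^ n * (c (k + n) * s ^ k)) sums 0"
      using less by (simp add: power_add mult_ac)
    with s show ?thesis
      by (simp add: sums_mult_iff[of "s ^ n" _ 0, simplified])
  qed
  then have "((\<lambda>_. 0) \<longlongrightarrow> c (0 + n)) (at (0::real))"
    by (intro powser_limit_0_strong[OF r]) auto
  then show ?case by (simp add: tendsto_const_iff)
qed

text \<open>The series of \<open>g\<close> defines an entire function, so its exponential is entire
  and has a Taylor series converging everywhere; near 0 this series must be the given one. The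
  passage to the complex plane is what yields an infinite radius of convergence, which real
  analyticity on the line alone would not give.\<close>

lemma power_series_exp_extend:
  fixes a c :: "nat \<Rightarrow> real"
  assumes c: "\<And>s. (\<lambda>n. c n * s ^ n) sums g s"
    and a: "\<And>s. \<bar>s\<bar> < 1 \<Longrightarrow> (\<lambda>n. a n * s ^ n) sums exp (g s)"
  shows "(\<lambda>n. a n * s ^ n) sums exp (g s)"
proof -
  define G where "G z = (\<Sum>n. complex_of_real (c n) * z ^ n)" for z
  \<comment> \<open>Real convergence at norm z + 1, a point of strictly larger modulus, implies
    convergence at \<open>z\<close>.\<close>
  have "summable (\<lambda>n. complex_of_real (c n) * z ^ n)" for z
  proof (rule powser_inside)
    show "summable (\<lambda>n. complex_of_real (c n) * complex_of_real (norm z + 1) ^ n)"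
      using sums_of_real[OF c[of "norm z + 1"], where 'a = complex] by (simp add: sums_iff)
    show "norm z < norm (complex_of_real (norm z + 1))"
      by (metis abs_of_nonneg add_nonneg_nonneg less_add_one norm_ge_zero norm_of_real zero_le_one)
  qed
  then have G: "(\<lambda>n. complex_of_real (c n) * z ^ n) sums G z" for z
    unfolding G_def by (rule summable_sums)
  have Gr: "G (of_real s) = of_real (g s)" for s
    using G[of "of_real s"] sums_of_real[OF c[of s], where 'a = complex]
    by (auto dest: sums_unique2)
  have hol: "(\<lambda>z. exp (G z)) holomorphic_on ball 0 r" for r
    by (intro holomorphic_on_compose_gen[of G _ exp UNIV, unfolded o_def]
          power_series_holomorphic[of 0 r "\<lambda>n. of_real (c n)"]) (use G in \<open>auto intro: holomorphic_intros\<close>)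
  \<comment> \<open>Taking real parts in the expansion at real \<open>s\<close> yields a real series
    without first proving that the Taylor coefficients are real.\<close>
  define b where "b n = Re ((deriv ^^ n) (\<lambda>z. exp (G z)) 0 / fact n)" for n
  have b: "(\<lambda>n. b n * s ^ n) sums exp (g s)" for s
  proof -
    have "(\<lambda>n. (deriv ^^ n) (\<lambda>z. exp (G z)) 0 / fact n * (of_real s - 0) ^ n) sums exp (G (of_real s))"
      by (rule holomorphic_power_series[OF hol[of "\<bar>s\<bar> + 1"]]) auto
    from sums_Re[OF this] show ?thesis
      unfolding Gr b_def exp_of_real diff_0_right of_real_power[symmetric]
      by (simp only: Re_complex_of_real times_complex.sel Im_complex_of_real mult_zero_right diff_0_right)
  qed
  have "(\<lambda>n. (a n - b n) * s ^ n) sums 0" if "\<bar>s\<bar> < 1" for s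
    using sums_diff[OF a[OF that] b[of s]] by (simp add: left_diff_distrib)
  then have "a n - b n = 0" for n
    by (intro powser_zero_imp_coeffs_zero[of 1 "\<lambda>n. a n - b n"]) auto
  then show ?thesis using b[of s] by simp
qed

section \<open>The Laplace exponent\<close>

text \<open>The formula obtained by differentiating under the integral;
  \<open>deriv_laplace_exponent\<close> shows that it is the actual derivative.\<close>

definition laplace_exponent_deriv :: "real \<Rightarrow> real measure \<Rightarrow> real \<Rightarrow> real" where
  "laplace_exponent_deriv d \<nu> y = d + (\<integral>u. u * exp (- y * u) \<partial>\<nu>)"

text \<open>Here \<open>a\<close> ranges over all reals. The measure may have infinite mass near 0,
  so a bare exponential need not be integrable; the integrands below therefore keep a factor that
  vanishes at 0.\<close>

locale exp_integrable_jumps =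
  fixes \<nu> :: "real measure"
  assumes sets_eq [measurable_cong]: "sets \<nu> = sets borel"
    and nonneg: "AE u in \<nu>. 0 \<le> u"
    and integrable_mult_exp: "integrable \<nu> (\<lambda>u. u * exp (a * u))"
begin

text \<open>One factor \<open>u\<close> is absorbed by exp u, which raises the exponent
  \<open>a\<close> by 1.\<close>

lemma integrable_square_mult_exp: "integrable \<nu> (\<lambda>u. u\<^sup>2 * exp (a * u))"
proof (rule Bochner_Integration.integrable_bound[OF integrable_mult_exp[of "a + 1"]])
  show "AE u in \<nu>. norm (u\<^sup>2 * exp (a * u)) \<le> norm (u * exp ((a + 1) * u))"
    using nonneg
  proof eventually_elim
    case (elim u)
    have "u \<le> exp u" using exp_ge_add_one_self[of u] by linarith
    then have "u * (u * exp (a * u)) \<le> u * (exp u * exp (a * u))"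
      using elim by (intro mult_left_mono mult_right_mono) auto
    then show ?case using elim by (simp add: power2_eq_square exp_add algebra_simps)
  qed
qed measurable

lemma integrable_mult_one_minus_exp:
  "integrable \<nu> (\<lambda>u. exp (a * u) * (1 - exp (b * u)))"
proof (rule Bochner_Integration.integrable_bound[OF integrable_mult_right[OF integrable_mult_exp[of "a + \<bar>b\<bar>"], of "\<bar>b\<bar>"]])
  show "AE u in \<nu>. norm (exp (a * u) * (1 - exp (b * u)))
      \<le> norm (\<bar>b\<bar> * (u * exp ((a + \<bar>b\<bar>) * u)))"
    using nonneg
  proof eventually_elim
    case (elim u)
    have "exp (a * u) * \<bar>exp (b * u) - 1\<bar> \<le> exp (a * u) * (\<bar>b * u\<bar> * exp \<bar>b * u\<bar>)"
      by (intro mult_left_mono exp_diff_one_le) simp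
    moreover have "norm (exp (a * u) * (1 - exp (b * u))) = exp (a * u) * \<bar>exp (b * u) - 1\<bar>"
      by (simp add: abs_mult abs_minus_commute)
    moreover have "exp (a * u) * (\<bar>b * u\<bar> * exp \<bar>b * u\<bar>) = norm (\<bar>b\<bar> * (u * exp ((a + \<bar>b\<bar>) * u)))"
      using elim by (simp add: abs_mult exp_add algebra_simps)
    ultimately show ?case by simp
  qed
qed measurable

lemma integrable_one_minus_exp: "integrable \<nu> (\<lambda>u. 1 - exp (b * u))"
  using integrable_mult_one_minus_exp[of 0 b] by simp

text \<open>The remainder is the integral of exp (- y u) * (exp (h u) - 1 - h u), hence
  non-negative. The integrand is at most h^2 u^2 exp ((|h| - y) u), and |h| \<le> 1 with y0 \<le> y
  replaces the exponent by 1 - y0, so that one constant serves the whole half-line.\<close>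

lemma laplace_exponent_remainder:
  fixes k d y0 y h :: real
  assumes "y0 \<le> y" "\<bar>h\<bar> \<le> 1"
  defines "R \<equiv> laplace_exponent k d \<nu> y - laplace_exponent k d \<nu> (y - h)
    - h * laplace_exponent_deriv d \<nu> y"
  shows "0 \<le> R" "R \<le> h\<^sup>2 * (\<integral>u. u\<^sup>2 * exp ((1 - y0) * u) \<partial>\<nu>)"
proof -
  have int: "integrable \<nu> (\<lambda>u. exp (- y * u) * (exp (h * u) - 1 - h * u))"
    using Bochner_Integration.integrable_diff[OF Bochner_Integration.integrable_minus[OF integrable_mult_one_minus_exp[of "- y" h]]
        integrable_mult_right[OF integrable_mult_exp[of "- y"], of h]]
    by (simp add: algebra_simps)
  have R: "R = (\<integral>u. exp (- y * u) * (exp (h * u) - 1 - h * u) \<partial>\<nu>)"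
  proof -
    have "R = (\<integral>u. 1 - exp (- y * u) \<partial>\<nu>) - (\<integral>u. 1 - exp (- (y - h) * u) \<partial>\<nu>)
        - h * (\<integral>u. u * exp (- y * u) \<partial>\<nu>)"
      by (simp add: R_def laplace_exponent_def laplace_exponent_deriv_def algebra_simps)
    also have "\<dots> = (\<integral>u. (1 - exp (- y * u)) - (1 - exp (- (y - h) * u)) - h * (u * exp (- y * u)) \<partial>\<nu>)"
      using integrable_one_minus_exp[of "- y"] integrable_one_minus_exp[of "- (y - h)"]
        integrable_mult_exp[of "- y"]
      by (simp only: Bochner_Integration.integral_diff Bochner_Integration.integrable_diff
          integral_mult_right_zero integrable_mult_right)
    also have "\<dots> = (\<integral>u. exp (- y * u) * (exp (h * u) - 1 - h * u) \<partial>\<nu>)"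
      by (intro Bochner_Integration.integral_cong refl)
        (simp add: algebra_simps flip: exp_add)
    finally show ?thesis .
  qed
  show "0 \<le> R"
    unfolding R by (intro Bochner_Integration.integral_nonneg mult_nonneg_nonneg exp_taylor2_nonneg) auto
  have "R \<le> (\<integral>u. h\<^sup>2 * (u\<^sup>2 * exp ((1 - y0) * u)) \<partial>\<nu>)"
    unfolding R
  proof (rule integral_mono_AE[OF int])
    show "integrable \<nu> (\<lambda>u. h\<^sup>2 * (u\<^sup>2 * exp ((1 - y0) * u)))"
      using integrable_square_mult_exp by simp
    show "AE u in \<nu>. exp (- y * u) * (exp (h * u) - 1 - h * u) \<le> h\<^sup>2 * (u\<^sup>2 * exp ((1 - y0) * u))"
      using nonneg
    proof eventually_elim
      case (elim u)
      have "exp (- y * u) * (exp (h * u) - 1 - h * u) \<le> exp (- y * u) * ((h * u)\<^sup>2 * exp \<bar>h * u\<bar>)"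
        by (intro mult_left_mono exp_taylor2_le) simp
      also have "\<dots> = h\<^sup>2 * u\<^sup>2 * exp (- y * u + \<bar>h\<bar> * u)"
        using elim by (simp only: exp_add abs_mult power_mult_distrib abs_of_nonneg mult_ac)
      also have "\<dots> \<le> h\<^sup>2 * u\<^sup>2 * exp ((1 - y0) * u)"
      proof -
        have "(\<bar>h\<bar> - y) * u \<le> (1 - y0) * u" using elim assms by (intro mult_right_mono) auto
        then show ?thesis by (intro mult_left_mono) (auto simp: algebra_simps)
      qed
      finally show ?case by (simp add: mult_ac)
    qed
  qed
  then show "R \<le> h\<^sup>2 * (\<integral>u. u\<^sup>2 * exp ((1 - y0) * u) \<partial>\<nu>)" by simp
qed

lemma laplace_exponent_deriv_antimono:
  assumes "x \<le> y"
  shows "laplace_exponent_deriv d \<nu> y \<le> laplace_exponent_deriv d \<nu> x"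
  unfolding laplace_exponent_deriv_def
proof (intro add_left_mono integral_mono_AE integrable_mult_exp)
  show "AE u in \<nu>. u * exp (- y * u) \<le> u * exp (- x * u)"
    using nonneg by eventually_elim (use assms in \<open>auto intro!: mult_left_mono mult_right_mono\<close>)
qed

lemma has_real_derivative_laplace_exponent:
  "(laplace_exponent k d \<nu> has_real_derivative laplace_exponent_deriv d \<nu> y) (at y)"
  unfolding DERIV_def
proof (rule LIM_zero_cancel, rule Lim_null_comparison)
  define V where "V = (\<integral>u. u\<^sup>2 * exp ((1 - y) * u) \<partial>\<nu>)"
  show "\<forall>\<^sub>F h in at 0. norm ((laplace_exponent k d \<nu> (y + h) - laplace_exponent k d \<nu> y) / h
      - laplace_exponent_deriv d \<nu> y) \<le> \<bar>h\<bar> * V"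
  proof (rule eventually_mono[of "\<lambda>h. h \<noteq> 0 \<and> \<bar>h\<bar> < 1"])
    show "\<forall>\<^sub>F h in at 0. h \<noteq> 0 \<and> \<bar>h\<bar> < (1::real)"
      unfolding eventually_at by (intro exI[of _ 1]) auto
  next
    fix h :: real
    assume h: "h \<noteq> 0 \<and> \<bar>h\<bar> < 1"
    let ?D = "(laplace_exponent k d \<nu> (y + h) - laplace_exponent k d \<nu> y) / h
      - laplace_exponent_deriv d \<nu> y"
    have "h * ?D = laplace_exponent k d \<nu> (y + h) - laplace_exponent k d \<nu> y
        - h * laplace_exponent_deriv d \<nu> y"
      using h by (simp add: field_simps)
    \<comment> \<open>The remainder for the increment \<open>- h\<close> equals - (h * ?D).\<close>
    then have "\<bar>h * ?D\<bar> \<le> h\<^sup>2 * V"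
      using laplace_exponent_remainder[of y y "- h" k d, folded V_def] h by simp
    then have "\<bar>h\<bar> * \<bar>?D\<bar> \<le> \<bar>h\<bar> * (\<bar>h\<bar> * V)"
      by (simp add: abs_mult power2_eq_square flip: mult.assoc)
    then show "norm ?D \<le> \<bar>h\<bar> * V"
      using h by simp
  qed
  show "((\<lambda>h. \<bar>h\<bar> * V) \<longlongrightarrow> 0) (at 0)"
    by (auto intro!: tendsto_eq_intros)
qed

lemma deriv_laplace_exponent: "deriv (laplace_exponent k d \<nu>) = laplace_exponent_deriv d \<nu>"
  using has_real_derivative_laplace_exponent DERIV_imp_deriv by blast

text \<open>Adding the Taylor bounds at \<open>y\<close> and at \<open>y - h\<close> cancels the values of the exponent.\<close>

lemma isCont_laplace_exponent_deriv: "isCont (laplace_exponent_deriv d \<nu>) y"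
  unfolding isCont_iff
proof (rule LIM_zero_cancel, rule Lim_null_comparison)
  \<comment> \<open>The base point \<open>y - 1\<close> lies below both \<open>y\<close> and
    \<open>y + h\<close>, so the same \<open>V\<close> bounds both remainders.\<close>
  define V where "V = (\<integral>u. u\<^sup>2 * exp ((1 - (y - 1)) * u) \<partial>\<nu>)"
  show "\<forall>\<^sub>F h in at 0. norm (laplace_exponent_deriv d \<nu> (y + h) - laplace_exponent_deriv d \<nu> y)
      \<le> 2 * \<bar>h\<bar> * V"
  proof (rule eventually_mono[of "\<lambda>h. h \<noteq> 0 \<and> \<bar>h\<bar> < 1"])
    show "\<forall>\<^sub>F h in at 0. h \<noteq> 0 \<and> \<bar>h\<bar> < (1::real)"
      unfolding eventually_at by (intro exI[of _ 1]) auto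
  next
    fix h :: real
    assume h: "h \<noteq> 0 \<and> \<bar>h\<bar> < 1"
    let ?D = "laplace_exponent_deriv d \<nu> (y + h) - laplace_exponent_deriv d \<nu> y"
    have "0 \<le> - (h * ?D)" "- (h * ?D) \<le> 2 * (h\<^sup>2 * V)"
      using laplace_exponent_remainder[of "y - 1" y "- h" 0 d]
        laplace_exponent_remainder[of "y - 1" "y + h" h 0 d] h
      unfolding V_def[symmetric] right_diff_distrib by (auto simp: abs_less_iff)
    then have "\<bar>h * ?D\<bar> \<le> 2 * (h\<^sup>2 * V)" by linarith
    then have "\<bar>h\<bar> * \<bar>?D\<bar> \<le> \<bar>h\<bar> * (2 * \<bar>h\<bar> * V)"
      by (simp add: abs_mult power2_eq_square mult_ac)
    then show "norm ?D \<le> 2 * \<bar>h\<bar> * V"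
      using h by simp
  qed
  show "((\<lambda>h. 2 * \<bar>h\<bar> * V) \<longlongrightarrow> 0) (at 0)"
    by (auto intro!: tendsto_eq_intros)
qed

text \<open>If the second moment of \<nu> vanishes, \<nu> is concentrated at 0 and the integral
  drops out. Otherwise t u \<le> exp (t u) makes the derivative at - t at least \<open>d\<close>
  plus t times the second moment, which is unbounded in t.\<close>

lemma laplace_exponent_deriv_cases:
  obtains (const) "\<And>y. laplace_exponent_deriv d \<nu> y = d"
  | (unbounded) "\<And>b. \<exists>y. b < laplace_exponent_deriv d \<nu> y"
proof (cases "(\<integral>u. u\<^sup>2 \<partial>\<nu>) = 0")
  case True
  have "AE u in \<nu>. u\<^sup>2 = 0"
    using True integral_nonneg_eq_0_iff_AE[of \<nu> "\<lambda>u. u\<^sup>2"] integrable_square_mult_exp[of 0] by simp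
  then have "laplace_exponent_deriv d \<nu> y = d" for y
    unfolding laplace_exponent_deriv_def by (auto intro!: integral_eq_zero_AE elim!: eventually_mono)
  then show ?thesis by (rule const)
next
  case False
  define m where "m = (\<integral>u. u\<^sup>2 \<partial>\<nu>)"
  have m: "m > 0" using False Bochner_Integration.integral_nonneg[of \<nu> "\<lambda>u. u\<^sup>2"] by (auto simp: m_def less_le)
  have le: "d + t * m \<le> laplace_exponent_deriv d \<nu> (- t)" if "0 \<le> t" for t
  proof -
    have "(\<integral>u. t * u\<^sup>2 \<partial>\<nu>) \<le> (\<integral>u. u * exp (- (- t) * u) \<partial>\<nu>)"
    proof (rule integral_mono_AE)
      show "AE u in \<nu>. t * u\<^sup>2 \<le> u * exp (- (- t) * u)"
        using nonneg
      proof eventually_elim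
        case (elim u)
        have "t * u \<le> exp (t * u)" using exp_ge_add_one_self[of "t * u"] by linarith
        then have "u * (t * u) \<le> u * exp (t * u)" using elim by (rule mult_left_mono)
        then show ?case by (simp add: power2_eq_square mult_ac)
      qed
    qed (use integrable_square_mult_exp[of 0] integrable_mult_exp[of t] in auto)
    then show ?thesis unfolding laplace_exponent_deriv_def m_def by simp
  qed
  have "\<exists>y. b < laplace_exponent_deriv d \<nu> y" for b
  proof -
    define t where "t = \<bar>b - d\<bar> / m + 1"
    have "t * m = \<bar>b - d\<bar> + m" using m by (simp add: t_def field_simps)
    then have "b < d + t * m" using m by linarith
    moreover have "0 \<le> t" using m by (simp add: t_def)
    ultimately show ?thesis using le[of t] by (intro exI[of _ "- t"]) linarith
  qed
  then show ?thesis by (rule unbounded)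
qed

end

section \<open>Continuation of the Laplace transform\<close>

context exp_integrable_jumps
begin

text \<open>Expansion around \<theta> = 1: 1 - exp (- (1 - s) u) splits into 1 - exp (- u) minus exp
  (- u) * (exp (s u) - 1). The latter has non-negative coefficients and is integrable for every
  \<open>s\<close>, so the series converges everywhere.\<close>

lemma laplace_exponent_power_series:
  obtains c where "\<And>s. (\<lambda>n. c n * s ^ n) sums (\<gamma> * laplace_exponent k d \<nu> (1 - s))"
proof -
  \<comment> \<open>The term n = 0 is dropped because exp (- u) need not be integrable under
    \<nu>.\<close>
  define f :: "nat \<Rightarrow> real \<Rightarrow> real"
    where "f n u = (if n = 0 then 0 else exp (- u) * (u ^ n / fact n))" for n u
  have f_sums: "(\<lambda>n. f n u * s ^ n) sums (exp (- u) * (exp (s * u) - 1))" for s u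
  proof -
    have "(\<lambda>n. (s * u) ^ n / fact n - (if n = 0 then 1 else 0)) sums (exp (s * u) - 1)"
      using exp_converges[of "s * u"] sums_single[of 0 "\<lambda>_. 1::real"]
      by (intro sums_diff) (auto simp: divide_inverse mult.commute)
    then have "(\<lambda>n. exp (- u) * ((s * u) ^ n / fact n - (if n = 0 then 1 else 0)))
        sums (exp (- u) * (exp (s * u) - 1))"
      by (rule sums_mult)
    then show ?thesis
      by (rule sums_cong[THEN iffD1, rotated]) (simp add: f_def power_mult_distrib mult_ac)
  qed
  have int_J: "integrable \<nu> (\<lambda>u. exp (- u) * (exp (s * u) - 1))" for s
    using Bochner_Integration.integrable_minus[OF integrable_mult_one_minus_exp[of "- 1" s]]
    by (simp add: algebra_simps)
  have J: "(\<lambda>n. (\<integral>u. f n u \<partial>\<nu>) * s ^ n) sums (\<integral>u. exp (- u) * (exp (s * u) - 1) \<partial>\<nu>)" for s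
  proof (rule sums_power_series_integral(2)[OF _ _ AE_I2 int_J, where f = f and r = "\<bar>s\<bar> + 1"])
    show "AE u in \<nu>. \<forall>n. 0 \<le> f n u"
      using nonneg by eventually_elim (auto simp: f_def)
    show "f n \<in> borel_measurable \<nu>" for n by (cases "n = 0") (simp_all add: f_def[abs_def])
  qed (auto intro: f_sums)
  have L: "laplace_exponent k d \<nu> (1 - s)
      = laplace_exponent k d \<nu> 1 - d * s - (\<integral>u. exp (- u) * (exp (s * u) - 1) \<partial>\<nu>)" for s
  proof -
    have "(\<integral>u. (1 - exp (- 1 * u)) - (exp (- u) * (exp (s * u) - 1)) \<partial>\<nu>)
        = (\<integral>u. (1 - exp (- 1 * u)) \<partial>\<nu>) - (\<integral>u. exp (- u) * (exp (s * u) - 1) \<partial>\<nu>)"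
      by (rule Bochner_Integration.integral_diff[OF integrable_one_minus_exp int_J])
    moreover have "(1 - exp (- 1 * u)) - (exp (- u) * (exp (s * u) - 1)) = 1 - exp (- (1 - s) * u)" for u
      by (simp add: algebra_simps flip: exp_add)
    ultimately show ?thesis by (simp add: laplace_exponent_def algebra_simps)
  qed
  define p where "p n = (if n = 0 then laplace_exponent k d \<nu> 1 else if n = 1 then - d else 0)" for n :: nat
  have p: "(\<lambda>n. p n * s ^ n) sums (laplace_exponent k d \<nu> 1 - d * s)" for s
    using sums_finite[of "{0, 1}" "\<lambda>n. p n * s ^ n"] by (simp add: p_def)
  show ?thesis
  proof
    show "(\<lambda>n. (\<gamma> * (p n - (\<integral>u. f n u \<partial>\<nu>))) * s ^ n) sums (\<gamma> * laplace_exponent k d \<nu> (1 - s))" for s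
      using sums_mult[OF sums_diff[OF p[of s] J[of s]], of \<gamma>] unfolding L
      by (simp add: algebra_simps)
  qed
qed

text \<open>Both sides are power series in \<open>s = 1 - \<theta>\<close>, and the right-hand side is entire. The series
  on the left has non-negative coefficients, so its convergence forces integrability.\<close>

lemma laplace_transform_extend:
  fixes X :: "'a \<Rightarrow> real"
  assumes prob: "prob_space M" and X[measurable]: "X \<in> borel_measurable M"
    and X_nonneg: "AE \<omega> in M. 0 \<le> X \<omega>"
    and law: "\<And>\<theta>. 0 \<le> \<theta> \<Longrightarrow>
      (\<integral>\<omega>. exp (- \<theta> * X \<omega>) \<partial>M) = exp (- \<gamma> * laplace_exponent k d \<nu> \<theta>)"
  shows "integrable M (\<lambda>\<omega>. exp (- \<theta> * X \<omega>))"
    and "(\<integral>\<omega>. exp (- \<theta> * X \<omega>) \<partial>M) = exp (- \<gamma> * laplace_exponent k d \<nu> \<theta>)"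
proof -
  interpret prob_space M by (rule prob)
  obtain c where c: "\<And>s. (\<lambda>n. c n * s ^ n) sums (- \<gamma> * laplace_exponent k d \<nu> (1 - s))"
    using laplace_exponent_power_series by blast
  define f where "f n \<omega> = exp (- X \<omega>) * (X \<omega> ^ n / fact n)" for n \<omega>
  have f_sums: "(\<lambda>n. f n \<omega> * s ^ n) sums exp (- (1 - s) * X \<omega>)" for s \<omega>
  proof -
    have "(\<lambda>n. exp (- X \<omega>) * ((s * X \<omega>) ^ n / fact n)) sums (exp (- X \<omega>) * exp (s * X \<omega>))"
      using exp_converges[of "s * X \<omega>"]
      by (intro sums_mult) (auto simp: divide_inverse mult.commute)
    moreover have "exp (- X \<omega>) * exp (s * X \<omega>) = exp (- (1 - s) * X \<omega>)"
      by (simp add: algebra_simps flip: exp_add)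
    ultimately show ?thesis
      by (simp add: f_def power_mult_distrib mult_ac)
  qed
  have f_nonneg: "AE \<omega> in M. \<forall>n. 0 \<le> f n \<omega>"
    using X_nonneg by eventually_elim (auto simp: f_def)
  have f_meas: "f n \<in> borel_measurable M" for n by (simp add: f_def[abs_def])
  have base: "integrable M (f n)"
      "(\<lambda>n. (\<integral>\<omega>. f n \<omega> \<partial>M) * s ^ n) sums (\<integral>\<omega>. exp (- (1 - s) * X \<omega>) \<partial>M)"
    if "\<bar>s\<bar> \<le> 1" for s n
  proof -
    \<comment> \<open>At s = 1 the sum is the constant 1, integrable under a probability measure;
      this alone gives the coefficients and the expansion for |s| \<le> 1.\<close>
    have "AE \<omega> in M. (\<lambda>n. f n \<omega> * 1 ^ n) sums 1"
      using f_sums[of _ 1] by simp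
    note * = sums_power_series_integral[OF f_meas f_nonneg this _ _ that AE_I2[OF f_sums]]
    show "integrable M (f n)" by (rule *(1)) auto
    show "(\<lambda>n. (\<integral>\<omega>. f n \<omega> \<partial>M) * s ^ n) sums (\<integral>\<omega>. exp (- (1 - s) * X \<omega>) \<partial>M)"
      by (rule *(2)) auto
  qed
  \<comment> \<open>For |s| < 1 the argument 1 - s is positive, so \<open>law\<close> identifies the
    sum there; \<open>power_series_exp_extend\<close> carries this to all \<open>s\<close>.\<close>
  have "(\<lambda>n. (\<integral>\<omega>. f n \<omega> \<partial>M) * s ^ n) sums exp (- \<gamma> * laplace_exponent k d \<nu> (1 - s))" for s
  proof (rule power_series_exp_extend[OF c])
    show "(\<lambda>n. (\<integral>\<omega>. f n \<omega> \<partial>M) * s ^ n) sums exp (- \<gamma> * laplace_exponent k d \<nu> (1 - s))"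
      if "\<bar>s\<bar> < 1" for s
      using base(2)[of s] law[of "1 - s"] that by simp
  qed
  note all = this
  have ext: "integrable M (\<lambda>\<omega>. exp (- (1 - s) * X \<omega>))"
      "(\<lambda>n. (\<integral>\<omega>. f n \<omega> \<partial>M) * s ^ n) sums (\<integral>\<omega>. exp (- (1 - s) * X \<omega>) \<partial>M)" for s
  proof -
    have "integrable M (f n)" for n using base(1)[of 0] by simp
    note * = sums_power_series_integral_converse[OF this f_nonneg AE_I2[OF f_sums]]
    have summ: "summable (\<lambda>n. (\<integral>\<omega>. f n \<omega> \<partial>M) * \<bar>s\<bar> ^ n)"
      using all by (rule sums_summable)
    show "integrable M (\<lambda>\<omega>. exp (- (1 - s) * X \<omega>))" by (rule *(1)[OF _ summ]) simp
    show "(\<lambda>n. (\<integral>\<omega>. f n \<omega> \<partial>M) * s ^ n) sums (\<integral>\<omega>. exp (- (1 - s) * X \<omega>) \<partial>M)"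
      by (rule *(2)[OF _ summ]) simp
  qed
  show "integrable M (\<lambda>\<omega>. exp (- \<theta> * X \<omega>))"
    using ext(1)[of "1 - \<theta>"] by simp
  show "(\<integral>\<omega>. exp (- \<theta> * X \<omega>) \<partial>M) = exp (- \<gamma> * laplace_exponent k d \<nu> \<theta>)"
    using sums_unique2[OF ext(2)[of "1 - \<theta>"] all[of "1 - \<theta>"]] by simp
qed

end

section \<open>Concentration of the tilted laws\<close>

text \<open>A quadratic penalty would not dominate \<open>\<Phi>\<close> at infinity, whereas this one does, and its
  expectation is read off the Laplace transform.\<close>

definition cosh_penalty :: "real \<Rightarrow> real \<Rightarrow> real" where
  "cosh_penalty a t = exp (a * t) + exp (- a * t) - 2"

text \<open>The factored form shows the sign and, for positive \<open>a\<close>, exponential growth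
  in |t| times a factor bounded away from 0 for |t| away from 0.\<close>

lemma cosh_penalty_eq: "cosh_penalty a t = exp (a * \<bar>t\<bar>) * (1 - exp (- a * \<bar>t\<bar>))\<^sup>2"
proof -
  have "cosh_penalty a t = cosh_penalty a \<bar>t\<bar>"
    by (cases "0 \<le> t") (auto simp: cosh_penalty_def)
  also have "\<dots> = exp (a * \<bar>t\<bar>) * (1 - exp (- a * \<bar>t\<bar>))\<^sup>2"
    by (simp add: cosh_penalty_def power2_eq_square algebra_simps flip: exp_add)
  finally show ?thesis .
qed

lemma cosh_penalty_nonneg: "0 \<le> cosh_penalty a t"
  by (simp add: cosh_penalty_eq)

text \<open>For \<open>z\<close> near \<open>x\<close>, uniform continuity on a compact interval
  gives \<epsilon>. At distance at least \<delta>, both values of \<Phi> are at most |C| exp (a R +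
  a |z - x|), and the penalty is at least \<kappa> exp (a |z - x|); \<open>A\<close> is the
  resulting quotient of constants.\<close>

lemma oscillation_le_cosh_penalty:
  fixes \<Phi> :: "real \<Rightarrow> real"
  assumes cont: "continuous_on {0..} \<Phi>" and nonneg: "\<And>x. 0 \<le> x \<Longrightarrow> 0 \<le> \<Phi> x"
    and growth: "\<And>x. 0 \<le> x \<Longrightarrow> \<Phi> x \<le> C * exp (c * x)" and \<epsilon>: "0 < \<epsilon>"
  obtains a A where "0 < a" "0 \<le> A"
    "\<And>x z. 0 \<le> x \<Longrightarrow> x \<le> R \<Longrightarrow> 0 \<le> z \<Longrightarrow> \<bar>\<Phi> z - \<Phi> x\<bar> \<le> \<epsilon> + A * cosh_penalty a (z - x)"
proof -
  define a where "a = \<bar>c\<bar> + 1"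
  have a: "0 < a" by (simp add: a_def)
  have "uniformly_continuous_on {0..R + 1} \<Phi>"
    by (intro compact_uniformly_continuous continuous_on_subset[OF cont]) auto
  from uniformly_continuous_onE[OF this \<epsilon>] obtain \<delta>0 where "0 < \<delta>0"
    and \<delta>0: "\<And>x z. x \<in> {0..R + 1} \<Longrightarrow> z \<in> {0..R + 1} \<Longrightarrow> dist z x < \<delta>0 \<Longrightarrow> dist (\<Phi> z) (\<Phi> x) < \<epsilon>"
    by metis
  \<comment> \<open>The cap at 1 keeps \<open>z\<close> inside the interval up to R + 1.\<close>
  define \<delta> where "\<delta> = min \<delta>0 1"
  have \<delta>: "0 < \<delta>" using \<open>0 < \<delta>0\<close> by (simp add: \<delta>_def)
  define \<kappa> where "\<kappa> = (1 - exp (- a * \<delta>))\<^sup>2"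
  have \<kappa>: "0 < \<kappa>" using a \<delta> by (auto simp: \<kappa>_def)
  define A where "A = 2 * \<bar>C\<bar> * exp (a * R) / \<kappa>"
  have A: "0 \<le> A" using \<kappa> by (simp add: A_def)
  have \<Phi>_le: "\<Phi> x \<le> \<bar>C\<bar> * exp (a * x)" if "0 \<le> x" for x
  proof -
    have "\<Phi> x \<le> C * exp (c * x)" using growth that .
    also have "\<dots> \<le> \<bar>C\<bar> * exp (a * x)"
    proof (rule mult_mono)
      have "c * x \<le> a * x" using that by (intro mult_right_mono) (auto simp: a_def)
      then show "exp (c * x) \<le> exp (a * x)" by simp
    qed auto
    finally show ?thesis .
  qed
  have "\<bar>\<Phi> z - \<Phi> x\<bar> \<le> \<epsilon> + A * cosh_penalty a (z - x)" if x: "0 \<le> x" "x \<le> R" and z: "0 \<le> z" for x z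
  proof (cases "\<bar>z - x\<bar> < \<delta>")
    case True
    then have "\<bar>\<Phi> z - \<Phi> x\<bar> < \<epsilon>"
      using \<delta>0[of x z] x z by (auto simp: \<delta>_def dist_real_def)
    then show ?thesis using A cosh_penalty_nonneg[of a "z - x"] by (smt (verit) mult_nonneg_nonneg)
  next
    case False
    let ?t = "\<bar>z - x\<bar>"
    have "\<bar>\<Phi> z - \<Phi> x\<bar> \<le> \<Phi> z + \<Phi> x" using nonneg[of z] nonneg[of x] x z by linarith
    also have "\<dots> \<le> \<bar>C\<bar> * exp (a * R + a * ?t) + \<bar>C\<bar> * exp (a * R + a * ?t)"
    proof (intro add_mono order_trans[OF \<Phi>_le] mult_left_mono)
      have "a * z \<le> a * (R + ?t)" "a * x \<le> a * (R + ?t)"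
        using a x by (auto intro!: mult_left_mono)
      then show "exp (a * z) \<le> exp (a * R + a * ?t)" "exp (a * x) \<le> exp (a * R + a * ?t)"
        by (auto simp: distrib_left)
    qed (use x z in auto)
    also have "\<dots> = A * (exp (a * ?t) * \<kappa>)"
      using \<kappa> by (simp add: A_def exp_add)
    also have "\<dots> \<le> A * cosh_penalty a (z - x)"
    proof -
      have "a * \<delta> \<le> a * ?t" using False a by (intro mult_left_mono) auto
      then have "\<kappa> \<le> (1 - exp (- a * ?t))\<^sup>2"
        unfolding \<kappa>_def using a \<delta> by (intro power_mono) auto
      then show ?thesis unfolding cosh_penalty_eq using A by (intro mult_left_mono) auto
    qed
    finally show ?thesis using \<epsilon> by linarith
  qed
  with a A show ?thesis by (rule that)
qed

text \<open>Each \<gamma> has its own probability space: only the one-dimensional laws enter, not a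
  process.\<close>

locale subordinator_marginals = exp_integrable_jumps \<nu>
  for \<nu> :: "real measure" +
  fixes k d :: real and M :: "real \<Rightarrow> 'a measure" and X :: "real \<Rightarrow> 'a \<Rightarrow> real"
  assumes drift_nonneg: "0 \<le> d"
    and prob: "0 < \<gamma> \<Longrightarrow> prob_space (M \<gamma>)"
    and X_measurable: "0 < \<gamma> \<Longrightarrow> X \<gamma> \<in> borel_measurable (M \<gamma>)"
    and X_nonneg: "0 < \<gamma> \<Longrightarrow> \<omega> \<in> space (M \<gamma>) \<Longrightarrow> 0 \<le> X \<gamma> \<omega>"
    and X_laplace_nonneg: "0 < \<gamma> \<Longrightarrow> 0 \<le> \<theta> \<Longrightarrow>
      (\<integral>\<omega>. exp (- \<theta> * X \<gamma> \<omega>) \<partial>M \<gamma>) = exp (- \<gamma> * laplace_exponent k d \<nu> \<theta>)"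
begin

lemma integrable_exp_X: "0 < \<gamma> \<Longrightarrow> integrable (M \<gamma>) (\<lambda>\<omega>. exp (- \<theta> * X \<gamma> \<omega>))"
  and X_laplace: "0 < \<gamma> \<Longrightarrow>
    (\<integral>\<omega>. exp (- \<theta> * X \<gamma> \<omega>) \<partial>M \<gamma>) = exp (- \<gamma> * laplace_exponent k d \<nu> \<theta>)"
proof -
  assume \<gamma>: "0 < \<gamma>"
  have "AE \<omega> in M \<gamma>. 0 \<le> X \<gamma> \<omega>" using X_nonneg[OF \<gamma>] by simp
  note * = laplace_transform_extend[OF prob[OF \<gamma>] X_measurable[OF \<gamma>] this X_laplace_nonneg[OF \<gamma>]]
  show "integrable (M \<gamma>) (\<lambda>\<omega>. exp (- \<theta> * X \<gamma> \<omega>))" by (rule *(1))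
  show "(\<integral>\<omega>. exp (- \<theta> * X \<gamma> \<omega>) \<partial>M \<gamma>) = exp (- \<gamma> * laplace_exponent k d \<nu> \<theta>)" by (rule *(2))
qed

lemma laplace_exponent_deriv_nonneg: "0 \<le> laplace_exponent_deriv d \<nu> y"
proof -
  have "0 \<le> (\<integral>u. u * exp (- y * u) \<partial>\<nu>)"
    using nonneg by (intro integral_nonneg_AE) (auto elim!: eventually_mono)
  then show ?thesis using drift_nonneg by (simp add: laplace_exponent_deriv_def)
qed

text \<open>Each exponential in the penalty shifts the tilt \<open>y\<close> by a / \<gamma> up or
  down, so the expectation is a combination of three Laplace transforms. Centring at the derivative
  at \<open>y\<close> cancels the first-order terms and leaves an excess of order 1 /
  \<gamma>.\<close>

lemma tilted_cosh_penalty: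
  assumes \<gamma>: "0 < \<gamma>" "a \<le> \<gamma>" and a: "0 < a" and y: "y0 \<le> y"
  defines "P \<equiv> \<lambda>\<omega>. cosh_penalty a (X \<gamma> \<omega> / \<gamma> - laplace_exponent_deriv d \<nu> y)"
    and "V \<equiv> \<integral>u. u\<^sup>2 * exp ((1 - y0) * u) \<partial>\<nu>"
  shows "integrable (M \<gamma>) (\<lambda>\<omega>. exp (- y * X \<gamma> \<omega>) * P \<omega>)"
    and "(\<integral>\<omega>. exp (- y * X \<gamma> \<omega>) * P \<omega> \<partial>M \<gamma>)
      \<le> 2 * (exp (a\<^sup>2 * V / \<gamma>) - 1) * (\<integral>\<omega>. exp (- y * X \<gamma> \<omega>) \<partial>M \<gamma>)"
proof -
  define x where "x = laplace_exponent_deriv d \<nu> y"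
  let ?L = "\<lambda>\<theta>. exp (- \<gamma> * laplace_exponent k d \<nu> \<theta>)"
  have expand: "exp (- y * X \<gamma> \<omega>) * P \<omega> = exp (- a * x) * exp (- (y - a / \<gamma>) * X \<gamma> \<omega>)
      + exp (a * x) * exp (- (y + a / \<gamma>) * X \<gamma> \<omega>) - 2 * exp (- y * X \<gamma> \<omega>)" for \<omega>
    by (simp add: P_def cosh_penalty_def x_def algebra_simps flip: exp_add)
  note int = integrable_exp_X[OF \<gamma>(1)]
  show "integrable (M \<gamma>) (\<lambda>\<omega>. exp (- y * X \<gamma> \<omega>) * P \<omega>)"
    unfolding expand using int
    by (intro Bochner_Integration.integrable_diff Bochner_Integration.integrable_add integrable_mult_right)
  \<comment> \<open>The condition a \<le> \<gamma> gives |h| \<le> 1; the quadratic remainder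
    contributes \<gamma> * (a / \<gamma>)^2 * V.\<close>
  have shift: "exp (- h * \<gamma> * x) * ?L (y - h) \<le> exp (a\<^sup>2 * V / \<gamma>) * ?L y" if h: "\<bar>h\<bar> = a / \<gamma>" for h
  proof -
    have "\<bar>h\<bar> \<le> 1" using \<gamma> a h by simp
    from laplace_exponent_remainder(2)[OF y this, of k d]
    have "laplace_exponent k d \<nu> y - laplace_exponent k d \<nu> (y - h) - h * x \<le> (a / \<gamma>)\<^sup>2 * V"
      unfolding V_def x_def h[symmetric] by simp
    then have "\<gamma> * (laplace_exponent k d \<nu> y - laplace_exponent k d \<nu> (y - h) - h * x) \<le> \<gamma> * ((a / \<gamma>)\<^sup>2 * V)"
      using \<gamma> by (intro mult_left_mono) auto
    also have "\<dots> = a\<^sup>2 * V / \<gamma>" using \<gamma> by (simp add: power2_eq_square)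
    finally show ?thesis by (simp add: algebra_simps flip: exp_add)
  qed
  have "(\<integral>\<omega>. exp (- y * X \<gamma> \<omega>) * P \<omega> \<partial>M \<gamma>)
      = exp (- a * x) * ?L (y - a / \<gamma>) + exp (a * x) * ?L (y + a / \<gamma>) - 2 * ?L y"
    unfolding expand X_laplace[OF \<gamma>(1), symmetric] using int
    by (simp only: Bochner_Integration.integral_diff Bochner_Integration.integral_add
        Bochner_Integration.integrable_add integral_mult_right_zero integrable_mult_right)
  also have "\<dots> \<le> 2 * (exp (a\<^sup>2 * V / \<gamma>) * ?L y) - 2 * ?L y"
    using shift[of "a / \<gamma>"] shift[of "- a / \<gamma>"] \<gamma> a by simp
  finally show "(\<integral>\<omega>. exp (- y * X \<gamma> \<omega>) * P \<omega> \<partial>M \<gamma>)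
      \<le> 2 * (exp (a\<^sup>2 * V / \<gamma>) - 1) * (\<integral>\<omega>. exp (- y * X \<gamma> \<omega>) \<partial>M \<gamma>)"
    unfolding X_laplace[OF \<gamma>(1)] by (simp add: algebra_simps)
qed

text \<open>\<Phi> is controlled only on the half-line; composing with max 0 gives a continuous
  function on the whole line that agrees with it on the values taken.\<close>

lemma borel_measurable_continuous_X:
  assumes \<gamma>: "0 < \<gamma>" and cont: "continuous_on {0..} \<Phi>"
  shows "(\<lambda>\<omega>. \<Phi> (X \<gamma> \<omega> / \<gamma>)) \<in> borel_measurable (M \<gamma>)"
proof -
  have "continuous_on UNIV (\<lambda>x. \<Phi> (max 0 x))"
    by (intro continuous_on_compose2[OF cont]) (auto intro!: continuous_intros)
  then have "(\<lambda>x. \<Phi> (max 0 x)) \<in> borel_measurable borel"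
    by (rule borel_measurable_continuous_onI)
  moreover have "(\<lambda>\<omega>. X \<gamma> \<omega> / \<gamma>) \<in> borel_measurable (M \<gamma>)"
    using X_measurable[OF \<gamma>] by simp
  ultimately have "(\<lambda>\<omega>. \<Phi> (max 0 (X \<gamma> \<omega> / \<gamma>))) \<in> borel_measurable (M \<gamma>)"
    by (rule measurable_compose[rotated])
  moreover have "\<Phi> (max 0 (X \<gamma> \<omega> / \<gamma>)) = \<Phi> (X \<gamma> \<omega> / \<gamma>)" if "\<omega> \<in> space (M \<gamma>)" for \<omega>
    using X_nonneg[OF \<gamma> that] \<gamma> by (simp add: max_def)
  ultimately show ?thesis
    using measurable_cong[of "M \<gamma>" "\<lambda>\<omega>. \<Phi> (max 0 (X \<gamma> \<omega> / \<gamma>))" "\<lambda>\<omega>. \<Phi> (X \<gamma> \<omega> / \<gamma>)" borel]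
    by simp
qed

text \<open>The oscillation bound is integrated against the tilted law: e / 2 comes from continuity
  and the penalty part vanishes by \<open>tilted_cosh_penalty\<close>. Uniformity holds because y0
  \<le> y confines the centre to [0, R], with R the derivative at \<open>y0\<close>.\<close>

lemma uniform_limit_tilted_expectation:
  fixes \<Phi> :: "real \<Rightarrow> real"
  assumes cont: "continuous_on {0..} \<Phi>" and \<Phi>_nonneg: "\<And>x. 0 \<le> x \<Longrightarrow> 0 \<le> \<Phi> x"
    and growth: "\<And>x. 0 \<le> x \<Longrightarrow> \<Phi> x \<le> C * exp (c * x)"
  shows "uniform_limit {y0..}
    (\<lambda>\<gamma> y. (\<integral>\<omega>. exp (- y * X \<gamma> \<omega>) * \<Phi> (X \<gamma> \<omega> / \<gamma>) \<partial>M \<gamma>) / (\<integral>\<omega>. exp (- y * X \<gamma> \<omega>) \<partial>M \<gamma>))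
    (\<lambda>y. \<Phi> (laplace_exponent_deriv d \<nu> y)) at_top"
proof (rule uniform_limitI)
  fix e :: real assume e: "0 < e"
  define R where "R = laplace_exponent_deriv d \<nu> y0"
  define V where "V = (\<integral>u. u\<^sup>2 * exp ((1 - y0) * u) \<partial>\<nu>)"
  obtain a A where a: "0 < a" and A: "0 \<le> A"
    and osc: "\<And>x z. 0 \<le> x \<Longrightarrow> x \<le> R \<Longrightarrow> 0 \<le> z \<Longrightarrow> \<bar>\<Phi> z - \<Phi> x\<bar> \<le> e / 2 + A * cosh_penalty a (z - x)"
    using oscillation_le_cosh_penalty[OF cont \<Phi>_nonneg growth, of "e / 2"] e by auto
  have "((\<lambda>\<gamma>. e / 2 + A * (2 * (exp (a\<^sup>2 * V / \<gamma>) - 1))) \<longlongrightarrow> e / 2 + A * (2 * (exp 0 - 1))) at_top"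
    by (intro tendsto_intros real_tendsto_divide_at_top[OF tendsto_const filterlim_ident])
  then have "\<forall>\<^sub>F \<gamma> in at_top. e / 2 + A * (2 * (exp (a\<^sup>2 * V / \<gamma>) - 1)) < e"
    by (rule order_tendstoD(2)) (use e in simp)
  from eventually_conj[OF this eventually_ge_at_top[of a]]
  show "\<forall>\<^sub>F \<gamma> in at_top. \<forall>y\<in>{y0..}.
      dist ((\<integral>\<omega>. exp (- y * X \<gamma> \<omega>) * \<Phi> (X \<gamma> \<omega> / \<gamma>) \<partial>M \<gamma>) / (\<integral>\<omega>. exp (- y * X \<gamma> \<omega>) \<partial>M \<gamma>))
        (\<Phi> (laplace_exponent_deriv d \<nu> y)) < e"
  proof (rule eventually_mono, intro ballI)
    fix \<gamma> y
    assume elim: "e / 2 + A * (2 * (exp (a\<^sup>2 * V / \<gamma>) - 1)) < e \<and> a \<le> \<gamma>" "y \<in> {y0..}"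
    have \<gamma>: "0 < \<gamma>" "a \<le> \<gamma>" and y: "y0 \<le> y" using elim a by auto
    define x where "x = laplace_exponent_deriv d \<nu> y"
    define D where "D = (\<integral>\<omega>. exp (- y * X \<gamma> \<omega>) \<partial>M \<gamma>)"
    have D: "0 < D" unfolding D_def X_laplace[OF \<gamma>(1)] by simp
    have x: "0 \<le> x" "x \<le> R"
      unfolding x_def R_def by (auto intro: laplace_exponent_deriv_nonneg laplace_exponent_deriv_antimono y)
    define P where "P \<omega> = cosh_penalty a (X \<gamma> \<omega> / \<gamma> - x)" for \<omega>
    note P = tilted_cosh_penalty[OF \<gamma> a y, folded x_def V_def, folded P_def D_def]
    note int = integrable_exp_X[OF \<gamma>(1), of y]
    have bound_int: "integrable (M \<gamma>) (\<lambda>\<omega>. e / 2 * exp (- y * X \<gamma> \<omega>) + A * (exp (- y * X \<gamma> \<omega>) * P \<omega>))"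
      using int P(1) by (intro Bochner_Integration.integrable_add integrable_mult_right)
    have bound: "\<bar>exp (- y * X \<gamma> \<omega>) * \<Phi> (X \<gamma> \<omega> / \<gamma>) - \<Phi> x * exp (- y * X \<gamma> \<omega>)\<bar>
        \<le> e / 2 * exp (- y * X \<gamma> \<omega>) + A * (exp (- y * X \<gamma> \<omega>) * P \<omega>)" if "\<omega> \<in> space (M \<gamma>)" for \<omega>
    proof -
      have "exp (- y * X \<gamma> \<omega>) * \<bar>\<Phi> (X \<gamma> \<omega> / \<gamma>) - \<Phi> x\<bar> \<le> exp (- y * X \<gamma> \<omega>) * (e / 2 + A * P \<omega>)"
        unfolding P_def using X_nonneg[OF \<gamma>(1) that] \<gamma> x by (intro mult_left_mono osc) auto
      moreover have "exp (- y * X \<gamma> \<omega>) * \<bar>\<Phi> (X \<gamma> \<omega> / \<gamma>) - \<Phi> x\<bar>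
          = \<bar>exp (- y * X \<gamma> \<omega>) * \<Phi> (X \<gamma> \<omega> / \<gamma>) - \<Phi> x * exp (- y * X \<gamma> \<omega>)\<bar>"
        by (simp add: abs_mult mult.commute flip: left_diff_distrib)
      ultimately show ?thesis by (simp add: algebra_simps)
    qed
    \<comment> \<open>Domination by the penalty also proves that the numerator is
      integrable.\<close>
    have diff_int: "integrable (M \<gamma>) (\<lambda>\<omega>. exp (- y * X \<gamma> \<omega>) * \<Phi> (X \<gamma> \<omega> / \<gamma>) - \<Phi> x * exp (- y * X \<gamma> \<omega>))"
    proof (rule Bochner_Integration.integrable_bound[OF bound_int])
      show "(\<lambda>\<omega>. exp (- y * X \<gamma> \<omega>) * \<Phi> (X \<gamma> \<omega> / \<gamma>) - \<Phi> x * exp (- y * X \<gamma> \<omega>)) \<in> borel_measurable (M \<gamma>)"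
        using X_measurable[OF \<gamma>(1)] borel_measurable_continuous_X[OF \<gamma>(1) cont] by measurable
    qed (use bound in \<open>fastforce intro: order_trans[OF _ abs_ge_self]\<close>)
    have num_int: "integrable (M \<gamma>) (\<lambda>\<omega>. exp (- y * X \<gamma> \<omega>) * \<Phi> (X \<gamma> \<omega> / \<gamma>))"
      using Bochner_Integration.integrable_add[OF diff_int integrable_mult_right[OF int, of "\<Phi> x"]] by simp
    have "\<bar>(\<integral>\<omega>. exp (- y * X \<gamma> \<omega>) * \<Phi> (X \<gamma> \<omega> / \<gamma>) \<partial>M \<gamma>) - \<Phi> x * D\<bar>
        = \<bar>\<integral>\<omega>. exp (- y * X \<gamma> \<omega>) * \<Phi> (X \<gamma> \<omega> / \<gamma>) - \<Phi> x * exp (- y * X \<gamma> \<omega>) \<partial>M \<gamma>\<bar>"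
      unfolding D_def using num_int int
      by (simp only: Bochner_Integration.integral_diff integral_mult_right_zero integrable_mult_right)
    also have "\<dots> \<le> (\<integral>\<omega>. e / 2 * exp (- y * X \<gamma> \<omega>) + A * (exp (- y * X \<gamma> \<omega>) * P \<omega>) \<partial>M \<gamma>)"
      using integral_abs_bound integral_mono[OF integrable_abs[OF diff_int] bound_int bound]
      by (rule order_trans)
    also have "\<dots> = e / 2 * D + A * (\<integral>\<omega>. exp (- y * X \<gamma> \<omega>) * P \<omega> \<partial>M \<gamma>)"
      unfolding D_def using int P(1)
      by (simp only: Bochner_Integration.integral_add integral_mult_right_zero integrable_mult_right)
    also have "\<dots> \<le> e / 2 * D + A * (2 * (exp (a\<^sup>2 * V / \<gamma>) - 1) * D)"
      using P(2) A by (intro add_left_mono mult_left_mono) auto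
    also have "\<dots> = (e / 2 + A * (2 * (exp (a\<^sup>2 * V / \<gamma>) - 1))) * D"
      by (simp add: algebra_simps)
    also have "\<dots> < e * D" using elim D by (intro mult_strict_right_mono) auto
    finally have "\<bar>(\<integral>\<omega>. exp (- y * X \<gamma> \<omega>) * \<Phi> (X \<gamma> \<omega> / \<gamma>) \<partial>M \<gamma>) - \<Phi> x * D\<bar> / D < e"
      using D by (simp add: divide_less_eq)
    moreover have "\<bar>N / D - \<Phi> x\<bar> = \<bar>N - \<Phi> x * D\<bar> / D" for N
    proof -
      have "N / D - \<Phi> x = (N - \<Phi> x * D) / D" using D by (simp add: field_simps)
      then show ?thesis using D by (simp add: abs_divide)
    qed
    ultimately show "dist ((\<integral>\<omega>. exp (- y * X \<gamma> \<omega>) * \<Phi> (X \<gamma> \<omega> / \<gamma>) \<partial>M \<gamma>) / (\<integral>\<omega>. exp (- y * X \<gamma> \<omega>) \<partial>M \<gamma>))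
        (\<Phi> (laplace_exponent_deriv d \<nu> y)) < e"
      unfolding D_def[symmetric] x_def[symmetric] dist_real_def by simp
  qed
qed

end

section \<open>Convergence of the ratio\<close>

text \<open>For finite non-zero \<open>y\<close>, \<open>exp_neg y\<close> is unbounded on the line,
  so the defining relation for bounded \<open>f\<close> does not apply to it directly. Indicators
  identify the law of \<open>Y\<close> with the image of the density g / c under \<open>X\<close>,
  after which any Borel \<open>f\<close> is allowed; a non-integrable \<open>f\<close> gives 0 on
  both sides.\<close>

lemma integral_eq_weighted_integral:
  fixes g :: "'a \<Rightarrow> real" and X :: "'a \<Rightarrow> real" and Y :: "'b \<Rightarrow> real"
  assumes N: "finite_measure N" and Y[measurable]: "Y \<in> borel_measurable N"
    and X[measurable]: "X \<in> borel_measurable M"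
    and g: "integrable M g" "AE \<omega> in M. 0 \<le> g \<omega>" and c: "0 < c"
    and law: "\<And>f. f \<in> borel_measurable borel \<Longrightarrow> bounded (range f) \<Longrightarrow>
      (\<integral>\<omega>. f (Y \<omega>) \<partial>N) = (\<integral>\<omega>. f (X \<omega>) * g \<omega> \<partial>M) / c"
    and f[measurable]: "f \<in> borel_measurable borel"
  shows "(\<integral>\<omega>. f (Y \<omega>) \<partial>N) = (\<integral>\<omega>. f (X \<omega>) * g \<omega> \<partial>M) / (c :: real)"
proof -
  interpret N: finite_measure N by (rule N)
  have [measurable]: "g \<in> borel_measurable M" using g by auto
  have "distr N borel Y = distr (density M (\<lambda>\<omega>. g \<omega> / c)) borel X"
  proof (rule measure_eqI)
    fix A assume "A \<in> sets (distr N borel Y)"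
    then have A[measurable]: "A \<in> sets borel" by simp
    have int: "integrable M (\<lambda>\<omega>. indicator A (X \<omega>) * g \<omega> / c)"
      by (intro integrable_divide Bochner_Integration.integrable_bound[OF g(1)])
        (auto simp: indicator_def)
    have "emeasure (distr N borel Y) A = ennreal (\<integral>\<omega>. indicator A (Y \<omega>) \<partial>N)"
    proof -
      have "(\<integral>\<omega>. indicator A (Y \<omega>) \<partial>N) = (\<integral>\<omega>. indicator (Y -` A \<inter> space N) \<omega> \<partial>N :: real)"
        by (intro Bochner_Integration.integral_cong) (auto simp: indicator_def)
      also have "\<dots> = measure N (Y -` A \<inter> space N)" by simp
      finally show ?thesis by (simp add: emeasure_distr N.emeasure_eq_measure)
    qed
    also have "\<dots> = ennreal (\<integral>\<omega>. indicator A (X \<omega>) * g \<omega> / c \<partial>M)"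
      by (subst law) (auto intro!: boundedI[of _ 1] simp: indicator_def)
    also have "\<dots> = (\<integral>\<^sup>+\<omega>. ennreal (indicator A (X \<omega>) * g \<omega> / c) \<partial>M)"
      using g(2) c by (intro nn_integral_eq_integral[OF int, symmetric]) (auto elim!: eventually_mono)
    also have "\<dots> = (\<integral>\<^sup>+\<omega>. ennreal (g \<omega> / c) * indicator (X -` A \<inter> space M) \<omega> \<partial>M)"
      by (intro nn_integral_cong) (auto simp: indicator_def)
    also have "\<dots> = emeasure (distr (density M (\<lambda>\<omega>. g \<omega> / c)) borel X) A"
      by (simp add: emeasure_distr emeasure_density)
    finally show "emeasure (distr N borel Y) A = emeasure (distr (density M (\<lambda>\<omega>. g \<omega> / c)) borel X) A" .
  qed simp
  then have "(\<integral>x. f x \<partial>distr N borel Y) = (\<integral>x. f x \<partial>distr (density M (\<lambda>\<omega>. g \<omega> / c)) borel X)"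
    by simp
  also have "\<dots> = (\<integral>\<omega>. f (X \<omega>) \<partial>density M (\<lambda>\<omega>. g \<omega> / c))"
    by (intro integral_distr) auto
  also have "\<dots> = (\<integral>\<omega>. g \<omega> / c * f (X \<omega>) \<partial>M)"
    using g(2) c by (subst integral_density) (auto elim!: eventually_mono)
  also have "\<dots> = (\<integral>\<omega>. f (X \<omega>) * g \<omega> \<partial>M) / c"
    by (simp add: mult.commute)
  finally show ?thesis by (simp add: integral_distr)
qed

lemma borel_measurable_exp_neg: "exp_neg y \<in> borel_measurable borel"
  by (cases "y = \<infinity>") (simp_all add: exp_neg_def[abs_def])

section \<open>Finite and infinite values of \<open>Upsilon\<close>\<close>

context exp_integrable_jumps
begin

text \<open>By monotonicity and the definition of the infimum, the derivative is at most
  \<open>x\<close> to the right of \<open>y\<close> and at least \<open>x\<close> to the left;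
  continuity gives equality without strict monotonicity.\<close>

lemma laplace_exponent_deriv_Upsilon:
  assumes "Upsilon k d \<nu> x = ereal y"
  shows "laplace_exponent_deriv d \<nu> y = x"
proof (rule antisym)
  have inf: "(INF y\<in>{y. laplace_exponent_deriv d \<nu> y \<le> x}. ereal y) = ereal y"
    using assms by (simp add: Upsilon_def deriv_laplace_exponent)
  have cont: "(laplace_exponent_deriv d \<nu> \<longlongrightarrow> laplace_exponent_deriv d \<nu> y) (at y within S)" for S
    using isCont_laplace_exponent_deriv[where d = d and y = y] by (auto simp: isCont_def intro: tendsto_within_subset)
  have right: "laplace_exponent_deriv d \<nu> z \<le> x" if "y < z" for z
  proof -
    have "(INF y\<in>{y. laplace_exponent_deriv d \<nu> y \<le> x}. ereal y) < ereal z"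
      using inf that by simp
    then obtain w where "laplace_exponent_deriv d \<nu> w \<le> x" "w < z"
      by (auto simp: INF_less_iff)
    then show ?thesis using laplace_exponent_deriv_antimono[of w z d] by linarith
  qed
  show "laplace_exponent_deriv d \<nu> y \<le> x"
    by (rule tendsto_upperbound[OF cont[of "{y<..}"]])
      (auto simp: eventually_at_filter intro!: always_eventually right)
  have left: "x \<le> laplace_exponent_deriv d \<nu> z" if "z < y" for z
  proof (rule ccontr)
    assume "\<not> ?thesis"
    then have "ereal y \<le> ereal z" unfolding inf[symmetric] by (intro INF_lower) auto
    with that show False by simp
  qed
  show "x \<le> laplace_exponent_deriv d \<nu> y"
    by (rule tendsto_lowerbound[OF cont[of "{..<y}"]])
      (auto simp: eventually_at_filter intro!: always_eventually left)
qed

text \<open>Supplies the half-line on which the uniform limit is applied. If the derivative is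
  constant, its sublevel sets are empty or the whole line, so \<open>Upsilon\<close> is never
  finite. Otherwise any \<open>y0\<close> where the derivative exceeds \<open>R\<close>
  works.\<close>

lemma Upsilon_bounded_below:
  obtains y0 where "\<And>x y. x \<le> R \<Longrightarrow> Upsilon k d \<nu> x = ereal y \<Longrightarrow> y0 \<le> y"
proof (cases rule: laplace_exponent_deriv_cases[where d = d])
  case const
  have "False" if U: "Upsilon k d \<nu> x = ereal y" for x y
  proof -
    have "d = x" using laplace_exponent_deriv_Upsilon[OF U] const by simp
    then have "Upsilon k d \<nu> x \<le> ereal (y - 1)"
      unfolding Upsilon_def deriv_laplace_exponent by (intro INF_lower) (use const[of "y - 1"] in auto)
    with U show False by simp
  qed
  then show ?thesis by (intro that) blast
next
  case unbounded
  then obtain y0 where "R < laplace_exponent_deriv d \<nu> y0" by blast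
  then have "y0 \<le> y" if "x \<le> R" "Upsilon k d \<nu> x = ereal y" for x y
    using laplace_exponent_deriv_Upsilon[OF that(2)] that(1) laplace_exponent_deriv_antimono[of y y0 d]
    by linarith
  then show ?thesis by (rule that)
qed

lemma Upsilon_infinite_imp_less:
  assumes "Upsilon k d \<nu> x = \<infinity>"
  shows "x < laplace_exponent_deriv d \<nu> y"
proof (rule ccontr)
  assume "\<not> ?thesis"
  then have "Upsilon k d \<nu> x \<le> ereal y"
    unfolding Upsilon_def deriv_laplace_exponent by (intro INF_lower) auto
  with assms show False by simp
qed

end

section \<open>The limit on the two parts of the domain\<close>

context subordinator_marginals
begin

text \<open>An infinite value means that the derivative exceeds \<open>x\<close> everywhere, so the
  exponent grows at least like x \<theta>. For positive \<open>x\<close> the Laplace transform of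
  \<open>X 1\<close> then tends to 0, although it is bounded below by the mass of the atom at
  0.\<close>

lemma ratio_domain_infinite:
  assumes x: "x \<in> ratio_domain k d \<nu> M X" and inf: "Upsilon k d \<nu> x = \<infinity>"
  shows "x = 0"
proof (rule ccontr)
  assume "x \<noteq> 0"
  with x have "0 < x" by (simp add: ratio_domain_def)
  define p where "p = (\<integral>\<omega>. exp_neg \<infinity> (X 1 \<omega>) \<partial>M 1)"
  interpret M: prob_space "M 1" by (rule prob) simp
  have p: "0 < p"
  proof -
    have "p \<noteq> 0" using x inf by (auto simp: ratio_domain_def p_def)
    moreover have "0 \<le> p"
      unfolding p_def by (intro Bochner_Integration.integral_nonneg) (simp add: exp_neg_def)
    ultimately show ?thesis by simp
  qed
  have le: "p \<le> exp (- laplace_exponent k d \<nu> 0 - x * \<theta>)" if \<theta>: "0 < \<theta>" for \<theta>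
  proof -
    have "p \<le> (\<integral>\<omega>. exp (- \<theta> * X 1 \<omega>) \<partial>M 1)"
      unfolding p_def by (intro integral_mono_AE' integrable_exp_X) (auto simp: exp_neg_def)
    also have "\<dots> = exp (- laplace_exponent k d \<nu> \<theta>)"
      using X_laplace[of 1 \<theta>] by simp
    also have "\<dots> \<le> exp (- laplace_exponent k d \<nu> 0 - x * \<theta>)"
    proof -
      obtain z where "laplace_exponent k d \<nu> \<theta> - laplace_exponent k d \<nu> 0 = (\<theta> - 0) * laplace_exponent_deriv d \<nu> z"
        using MVT2[OF \<theta>, of "laplace_exponent k d \<nu>" "laplace_exponent_deriv d \<nu>"]
          has_real_derivative_laplace_exponent by blast
      moreover have "\<theta> * x \<le> \<theta> * laplace_exponent_deriv d \<nu> z"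
        using \<theta> Upsilon_infinite_imp_less[OF inf, of z] by (intro mult_left_mono) auto
      ultimately show ?thesis by (simp add: mult.commute)
    qed
    finally show ?thesis .
  qed
  have "((\<lambda>\<theta>. exp (- laplace_exponent k d \<nu> 0 - x * \<theta>)) \<longlongrightarrow> 0) at_top"
    using \<open>0 < x\<close> by real_asymp
  moreover have "\<forall>\<^sub>F \<theta> in at_top. p \<le> exp (- laplace_exponent k d \<nu> 0 - x * \<theta>)"
    using eventually_gt_at_top[of 0] by eventually_elim (rule le)
  ultimately have "p \<le> 0" by (intro tendsto_lowerbound) auto
  with p show False by simp
qed

text \<open>Where \<open>Upsilon\<close> is finite the ratio is eventually \<open>Q\<close> at that
  value divided by \<open>m\<close>, and \<open>m\<close> tends to 1. Where it is infinite the ratio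
  is eventually \<Phi> 0 / m at the single possible point x = 0.\<close>

lemma uniform_limit_laplace_ratio:
  fixes \<Phi> :: "real \<Rightarrow> real" and N :: "real \<Rightarrow> 'b measure" and Y :: "real \<Rightarrow> 'b \<Rightarrow> real"
  assumes \<Phi>_cont: "continuous_on {0..} \<Phi>"
    and \<Phi>_nonneg: "\<And>x. 0 \<le> x \<Longrightarrow> 0 \<le> \<Phi> x"
    and \<Phi>_growth: "\<And>x. 0 \<le> x \<Longrightarrow> \<Phi> x \<le> C * exp (c * x)"
    and \<Phi>_normalized: "\<Phi> (laplace_exponent_deriv d \<nu> 0) = 1"
    and N: "\<And>\<gamma>. 0 < \<gamma> \<Longrightarrow> prob_space (N \<gamma>)"
    and Y: "\<And>\<gamma>. 0 < \<gamma> \<Longrightarrow> Y \<gamma> \<in> borel_measurable (N \<gamma>)"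
    and Y_law: "\<And>\<gamma> f. 0 < \<gamma> \<Longrightarrow> (\<integral>\<omega>. \<Phi> (X \<gamma> \<omega> / \<gamma>) \<partial>M \<gamma>) \<noteq> 0 \<Longrightarrow>
        f \<in> borel_measurable borel \<Longrightarrow> bounded (range f) \<Longrightarrow>
        (\<integral>\<omega>. f (Y \<gamma> \<omega>) \<partial>N \<gamma>) =
          (\<integral>\<omega>. f (X \<gamma> \<omega>) * \<Phi> (X \<gamma> \<omega> / \<gamma>) \<partial>M \<gamma>) / (\<integral>\<omega>. \<Phi> (X \<gamma> \<omega> / \<gamma>) \<partial>M \<gamma>)"
    and K: "compact K" "K \<subseteq> {0..}"
  shows "uniform_limit (K \<inter> ratio_domain k d \<nu> M X)
      (\<lambda>\<gamma> x. (\<integral>\<omega>. exp_neg (Upsilon k d \<nu> x) (Y \<gamma> \<omega>) \<partial>N \<gamma>) /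
              (\<integral>\<omega>. exp_neg (Upsilon k d \<nu> x) (X \<gamma> \<omega>) \<partial>M \<gamma>))
      \<Phi> at_top"
proof -
  define D where "D = K \<inter> ratio_domain k d \<nu> M X"
  define Fin where "Fin = {x \<in> D. Upsilon k d \<nu> x \<noteq> \<infinity>}"
  define Inf where "Inf = {x \<in> D. Upsilon k d \<nu> x = \<infinity>}"
  define v where "v x = real_of_ereal (Upsilon k d \<nu> x)" for x
  define m where "m \<gamma> = (\<integral>\<omega>. \<Phi> (X \<gamma> \<omega> / \<gamma>) \<partial>M \<gamma>)" for \<gamma>
  define Q where "Q \<gamma> y = (\<integral>\<omega>. exp (- y * X \<gamma> \<omega>) * \<Phi> (X \<gamma> \<omega> / \<gamma>) \<partial>M \<gamma>) /
    (\<integral>\<omega>. exp (- y * X \<gamma> \<omega>) \<partial>M \<gamma>)" for \<gamma> y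
  define r where "r \<gamma> x = (\<integral>\<omega>. exp_neg (Upsilon k d \<nu> x) (Y \<gamma> \<omega>) \<partial>N \<gamma>) /
    (\<integral>\<omega>. exp_neg (Upsilon k d \<nu> x) (X \<gamma> \<omega>) \<partial>M \<gamma>)" for \<gamma> x
  have Upsilon_v: "Upsilon k d \<nu> x = ereal (v x)" if "x \<in> Fin" for x
    using that by (cases "Upsilon k d \<nu> x") (auto simp: v_def Fin_def D_def ratio_domain_def)
  obtain R where R': "\<forall>x\<in>K. norm x \<le> R"
    using compact_imp_bounded[OF K(1)] unfolding bounded_iff by blast
  then have R: "x \<le> R" if "x \<in> K" for x
    using that by fastforce
  obtain y0 where y0: "\<And>x y. x \<le> R \<Longrightarrow> Upsilon k d \<nu> x = ereal y \<Longrightarrow> y0 \<le> y"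
    using Upsilon_bounded_below by blast
  \<comment> \<open>The half-line is enlarged to contain 0, since \<open>Q\<close> at 0 is the
    normalising constant \<open>m\<close>.\<close>
  have Q: "uniform_limit {min y0 0..} Q (\<lambda>y. \<Phi> (laplace_exponent_deriv d \<nu> y)) at_top"
    unfolding Q_def by (rule uniform_limit_tilted_expectation[OF \<Phi>_cont \<Phi>_nonneg \<Phi>_growth])
  have "((\<lambda>\<gamma>. Q \<gamma> 0) \<longlongrightarrow> 1) at_top"
    using tendsto_uniform_limitI[OF Q, of 0] \<Phi>_normalized by simp
  moreover have "Q \<gamma> 0 = m \<gamma>" if "0 < \<gamma>" for \<gamma>
    using prob_space.prob_space[OF prob[OF that]] by (simp add: Q_def m_def)
  then have "\<forall>\<^sub>F \<gamma> in at_top. Q \<gamma> 0 = m \<gamma>"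
    using eventually_gt_at_top[of "0::real"] by (rule eventually_mono[rotated])
  ultimately have m: "(m \<longlongrightarrow> 1) at_top"
    by (rule Lim_transform_eventually)
  have ev: "\<forall>\<^sub>F \<gamma> in at_top. 0 < \<gamma> \<and> 0 < m \<gamma>"
    using eventually_conj[OF eventually_gt_at_top[of "0::real"] order_tendstoD(1)[OF m, of 0]] by simp
  have Y_integral: "(\<integral>\<omega>. exp_neg y (Y \<gamma> \<omega>) \<partial>N \<gamma>)
      = (\<integral>\<omega>. exp_neg y (X \<gamma> \<omega>) * \<Phi> (X \<gamma> \<omega> / \<gamma>) \<partial>M \<gamma>) / m \<gamma>"
    if \<gamma>: "0 < \<gamma> \<and> 0 < m \<gamma>" for \<gamma> y
  proof (rule integral_eq_weighted_integral[where f = "exp_neg y" and X = "X \<gamma>" and Y = "Y \<gamma>"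
        and g = "\<lambda>\<omega>. \<Phi> (X \<gamma> \<omega> / \<gamma>)"])
    show "finite_measure (N \<gamma>)" using N \<gamma> by (simp add: prob_space.finite_measure)
    \<comment> \<open>A non-integrable function would have integral 0, contradicting 0 < m
      \<gamma>.\<close>
    show "integrable (M \<gamma>) (\<lambda>\<omega>. \<Phi> (X \<gamma> \<omega> / \<gamma>))"
      using \<gamma> not_integrable_integral_eq unfolding m_def by fastforce
    show "AE \<omega> in M \<gamma>. 0 \<le> \<Phi> (X \<gamma> \<omega> / \<gamma>)"
      using X_nonneg \<gamma> by (intro AE_I2 \<Phi>_nonneg) simp
    show "(\<integral>\<omega>. f (Y \<gamma> \<omega>) \<partial>N \<gamma>) = (\<integral>\<omega>. f (X \<gamma> \<omega>) * \<Phi> (X \<gamma> \<omega> / \<gamma>) \<partial>M \<gamma>) / m \<gamma>"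
      if "f \<in> borel_measurable borel" "bounded (range f)" for f
      using Y_law[of \<gamma> f] \<gamma> that by (simp add: m_def)
  qed (use \<gamma> Y X_measurable borel_measurable_exp_neg in simp_all)
  have "uniform_limit Fin r \<Phi> at_top"
  proof -
    have v: "v \<in> Fin \<rightarrow> {min y0 0..}"
    proof
      fix x assume x: "x \<in> Fin"
      then have "x \<le> R" by (intro R) (auto simp: Fin_def D_def)
      from y0[OF this Upsilon_v[OF x]] show "v x \<in> {min y0 0..}" by simp
    qed
    have "uniform_limit Fin (\<lambda>\<gamma> x. Q \<gamma> (v x)) (\<lambda>x. \<Phi> (laplace_exponent_deriv d \<nu> (v x))) at_top"
      by (rule uniform_limit_compose'[OF Q v])
    then have Qv: "uniform_limit Fin (\<lambda>\<gamma> x. Q \<gamma> (v x)) \<Phi> at_top"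
      by (rule uniform_limit_cong'[THEN iffD1, rotated 2])
        (simp_all add: laplace_exponent_deriv_Upsilon[OF Upsilon_v])
    \<comment> \<open>Boundedness of the limit is required for dividing uniform limits.\<close>
    have "compact (\<Phi> ` K)"
      by (intro compact_continuous_image continuous_on_subset[OF \<Phi>_cont] K)
    then have "bounded (\<Phi> ` Fin)"
      by (rule bounded_subset[OF compact_imp_bounded]) (auto simp: Fin_def D_def)
    moreover have "uniform_limit Fin (\<lambda>\<gamma> x. m \<gamma>) (\<lambda>x. 1) at_top"
      by (rule uniform_limitI) (use tendstoD[OF m] in \<open>auto elim!: eventually_mono\<close>)
    ultimately have "uniform_limit Fin (\<lambda>\<gamma> x. Q \<gamma> (v x) / m \<gamma>) (\<lambda>x. \<Phi> x / 1) at_top"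
      using Qv by (intro uniform_lim_divide[where b = 1]) auto
    then show ?thesis
    proof (rule uniform_limit_cong[THEN iffD1, rotated 2])
      show "\<forall>\<^sub>F \<gamma> in at_top. \<forall>x\<in>Fin. Q \<gamma> (v x) / m \<gamma> = r \<gamma> x"
        using ev
      proof eventually_elim
        case (elim \<gamma>)
        have "Q \<gamma> (v x) / m \<gamma> = r \<gamma> x" if "x \<in> Fin" for x
        proof -
          have "exp_neg (Upsilon k d \<nu> x) u = exp (- v x * u)" for u
            by (simp add: Upsilon_v[OF that] exp_neg_def)
          with Y_integral[OF elim, of "Upsilon k d \<nu> x"] show ?thesis
            by (simp only: r_def Q_def divide_divide_eq_left mult.commute)
        qed
        then show ?case by blast
      qed
    qed simp
  qed
  moreover have "uniform_limit Inf r \<Phi> at_top"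
  proof -
    have Inf0: "x = 0" if "x \<in> Inf" for x
      using ratio_domain_infinite that by (auto simp: Inf_def D_def)
    have "((\<lambda>\<gamma>. \<Phi> 0 / m \<gamma>) \<longlongrightarrow> \<Phi> 0 / 1) at_top"
      by (intro tendsto_intros m) simp
    from tendstoD[OF this] have "uniform_limit Inf (\<lambda>\<gamma> x. \<Phi> 0 / m \<gamma>) (\<lambda>x. \<Phi> 0) at_top"
      by (intro uniform_limitI) (auto elim!: eventually_mono)
    then show ?thesis
    proof (rule uniform_limit_cong[THEN iffD1, rotated 2])
      show "\<forall>\<^sub>F \<gamma> in at_top. \<forall>x\<in>Inf. \<Phi> 0 / m \<gamma> = r \<gamma> x"
        using ev
      proof eventually_elim
        case (elim \<gamma>)
        show ?case
        proof
          fix x assume x: "x \<in> Inf"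
          then have U: "Upsilon k d \<nu> x = \<infinity>" by (simp add: Inf_def)
          define p where "p = (\<integral>\<omega>. exp_neg \<infinity> (X \<gamma> \<omega>) \<partial>M \<gamma>)"
          have p: "p \<noteq> 0"
            using x elim U by (auto simp: Inf_def D_def ratio_domain_def p_def)
          \<comment> \<open>The weight is the indicator of X = 0, so \<Phi> is evaluated only at
            0.\<close>
          have "(\<integral>\<omega>. exp_neg \<infinity> (X \<gamma> \<omega>) * \<Phi> (X \<gamma> \<omega> / \<gamma>) \<partial>M \<gamma>)
              = (\<integral>\<omega>. exp_neg \<infinity> (X \<gamma> \<omega>) * \<Phi> 0 \<partial>M \<gamma>)"
            by (intro Bochner_Integration.integral_cong) (auto simp: exp_neg_def)
          then have "(\<integral>\<omega>. exp_neg \<infinity> (Y \<gamma> \<omega>) \<partial>N \<gamma>) = p * \<Phi> 0 / m \<gamma>"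
            unfolding Y_integral[OF elim] p_def by simp
          then show "\<Phi> 0 / m \<gamma> = r \<gamma> x"
            using p by (simp add: r_def U flip: p_def)
        qed
      qed
    qed (use Inf0 in blast)
  qed
  ultimately have "uniform_limit (Fin \<union> Inf) r \<Phi> at_top" by (rule uniform_limit_on_Un)
  moreover have "Fin \<union> Inf = D" by (auto simp: Fin_def Inf_def)
  ultimately show ?thesis by (simp add: D_def r_def[abs_def])
qed

end

text \<open>A continuous integrable function can have arbitrarily tall narrow spikes, so
  integrability does not bound \<Phi> at infinity; the growth hypothesis makes its expectations
  finite, all exponential moments of X being finite.\<close>

theorem theorem2p14:
  fixes k d :: real
    and \<nu> :: "real measure"
    and \<Phi> :: "real \<Rightarrow> real"
    and M :: "real \<Rightarrow> 'a measure" and X :: "real \<Rightarrow> 'a \<Rightarrow> real"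
    and N :: "real \<Rightarrow> 'b measure" and Y :: "real \<Rightarrow> 'b \<Rightarrow> real"
  assumes triplet: "subordinator_triplet k d \<nu>"
    and exp_moments: "\<And>\<alpha>. 0 \<le> \<alpha> \<Longrightarrow> integrable \<nu> (\<lambda>u. exp (\<alpha> * u) * u)"
    and prob_M: "\<And>\<gamma>. 0 < \<gamma> \<Longrightarrow> prob_space (M \<gamma>)"
    and X_meas: "\<And>\<gamma>. 0 < \<gamma> \<Longrightarrow> X \<gamma> \<in> borel_measurable (M \<gamma>)"
    and X_nonneg: "\<And>\<gamma> \<omega>. 0 < \<gamma> \<Longrightarrow> \<omega> \<in> space (M \<gamma>) \<Longrightarrow> 0 \<le> X \<gamma> \<omega>"
    and X_law: "\<And>\<gamma> \<theta>. 0 < \<gamma> \<Longrightarrow> 0 \<le> \<theta> \<Longrightarrow>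
        (\<integral>\<omega>. exp (- \<theta> * X \<gamma> \<omega>) \<partial>M \<gamma>) = exp (- \<gamma> * laplace_exponent k d \<nu> \<theta>)"
    and \<Phi>_cont: "continuous_on {0..} \<Phi>"
    and \<Phi>_nonneg: "\<And>x. 0 \<le> x \<Longrightarrow> 0 \<le> \<Phi> x"
    and \<Phi>_integrable: "set_integrable lborel {0..} \<Phi>"
    and \<Phi>_growth: "\<exists>C c. \<forall>x\<ge>0. \<Phi> x \<le> C * exp (c * x)"
    and \<Phi>_normalized: "\<Phi> (deriv (laplace_exponent k d \<nu>) 0) = 1"
    and prob_N: "\<And>\<gamma>. 0 < \<gamma> \<Longrightarrow> prob_space (N \<gamma>)"
    and Y_meas: "\<And>\<gamma>. 0 < \<gamma> \<Longrightarrow> Y \<gamma> \<in> borel_measurable (N \<gamma>)"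
    and Y_law: "\<And>\<gamma> f. 0 < \<gamma> \<Longrightarrow> (\<integral>\<omega>. \<Phi> (X \<gamma> \<omega> / \<gamma>) \<partial>M \<gamma>) \<noteq> 0 \<Longrightarrow>
        f \<in> borel_measurable borel \<Longrightarrow> bounded (range f) \<Longrightarrow>
        (\<integral>\<omega>. f (Y \<gamma> \<omega>) \<partial>N \<gamma>) =
          (\<integral>\<omega>. f (X \<gamma> \<omega>) * \<Phi> (X \<gamma> \<omega> / \<gamma>) \<partial>M \<gamma>) / (\<integral>\<omega>. \<Phi> (X \<gamma> \<omega> / \<gamma>) \<partial>M \<gamma>)"
  shows "\<forall>K. compact K \<and> K \<subseteq> {0..} \<longrightarrow>
    uniform_limit (K \<inter> ratio_domain k d \<nu> M X)
      (\<lambda>\<gamma> x. (\<integral>\<omega>. exp_neg (Upsilon k d \<nu> x) (Y \<gamma> \<omega>) \<partial>N \<gamma>) /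
              (\<integral>\<omega>. exp_neg (Upsilon k d \<nu> x) (X \<gamma> \<omega>) \<partial>M \<gamma>))
      \<Phi> at_top"
proof -
  have sets: "sets \<nu> = sets borel" and d: "0 \<le> d"
    and null: "emeasure \<nu> {..<0} = 0"
    using triplet by (auto simp: subordinator_triplet_def)
  have nonneg: "AE u in \<nu>. 0 \<le> u"
    by (rule AE_I[of _ _ "{..<0}"]) (use sets null in auto)
  have [measurable_cong]: "sets \<nu> = sets borel" by (rule sets)
  \<comment> \<open>Negative exponents are dominated by their absolute value, as u \<ge> 0 almost
    everywhere.\<close>
  have moments: "integrable \<nu> (\<lambda>u. u * exp (a * u))" for a
  proof (rule Bochner_Integration.integrable_bound[OF exp_moments[of "\<bar>a\<bar>"]])
    show "AE u in \<nu>. norm (u * exp (a * u)) \<le> norm (exp (\<bar>a\<bar> * u) * u)"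
      using nonneg by eventually_elim (auto simp: abs_mult mult.commute intro!: mult_left_mono mult_right_mono)
  qed auto
  interpret subordinator_marginals \<nu> k d M X
    by (intro subordinator_marginals.intro exp_integrable_jumps.intro subordinator_marginals_axioms.intro)
      (rule sets nonneg moments d prob_M X_meas X_nonneg X_law; assumption)+
  obtain C c where "\<And>x. 0 \<le> x \<Longrightarrow> \<Phi> x \<le> C * exp (c * x)" using \<Phi>_growth by blast
  with uniform_limit_laplace_ratio[OF \<Phi>_cont \<Phi>_nonneg _ _ prob_N Y_meas Y_law] \<Phi>_normalized
  show ?thesis unfolding deriv_laplace_exponent by blast
qed

end
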